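(* Let $R$, $S$, $T$ be rings, $C$ an $R$-coring and let $F : {}_R^C\mathcal{M} \to {}_S\mathcal{M}$ and $G : {}_S\mathcal{M} \to {}_T\mathcal{M}$ be representable functors. Then $G\circ F : {}_R^C\mathcal{M}\to {}_T\mathcal{M}$ is a representable functor.
   Context: Rings are associative with unit. ${}_S\mathcal{M}$ is the category of left $S$-modules. An $R$-coring $C=(C,\Delta,\varepsilon)$ is a comonoid in the monoidal category of $R$-bimodules $({}_R\mathcal{M}_R, \otimes_R, R)$. ${}_R^C\mathcal{M}$ is the category of left $C$-comodules: left $R$-modules $M$ with a left $R$-linear coassociative and counital coaction $\rho: M\to C\otimes_R M$; morphisms are left $R$-linear maps compatible with the coactions. A (covariant) functor $F$ from a category $\mathcal{C}$ to a category of left modules ${}_S\mathcal{M}$ is called representable if its composition with the forgetful functor ${}_S\mathcal{M}\to\mathcal{S}et$ is representable in the classical sense, i.e. isomorphic to ${\rm Hom}_{\mathcal{C}}(X,-)$ for some $X\in\mathcal{C}$. *)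

theory Defs
  imports "HOL-Algebra.Algebra" "HOL-Library.Equipollence"
begin

section \<open>Left modules and bimodules over a (not necessarily commutative) ring\<close>

text \<open>The locale \<^locale>\<open>module\<close> of the library requires a commutative ring of scalars.
  We keep its record type; the ring fields \<open>mult\<close> and \<open>one\<close> of that record
  are unused, as they are in \<^locale>\<open>module\<close>.\<close>

locale left_module = R?: ring R + M?: abelian_group M
  for R :: "('r, 'p) ring_scheme" (structure) and M :: "('r, 'm, 'q) module_scheme" (structure) +
  assumes smult_closed:
      "\<lbrakk>a \<in> carrier R; x \<in> carrier M\<rbrakk> \<Longrightarrow> a \<odot>\<^bsub>M\<^esub> x \<in> carrier M"
    and smult_l_distr:
      "\<lbrakk>a \<in> carrier R; b \<in> carrier R; x \<in> carrier M\<rbrakk> \<Longrightarrow>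
        (a \<oplus>\<^bsub>R\<^esub> b) \<odot>\<^bsub>M\<^esub> x = a \<odot>\<^bsub>M\<^esub> x \<oplus>\<^bsub>M\<^esub> b \<odot>\<^bsub>M\<^esub> x"
    and smult_r_distr:
      "\<lbrakk>a \<in> carrier R; x \<in> carrier M; y \<in> carrier M\<rbrakk> \<Longrightarrow>
        a \<odot>\<^bsub>M\<^esub> (x \<oplus>\<^bsub>M\<^esub> y) = a \<odot>\<^bsub>M\<^esub> x \<oplus>\<^bsub>M\<^esub> a \<odot>\<^bsub>M\<^esub> y"
    and smult_assoc:
      "\<lbrakk>a \<in> carrier R; b \<in> carrier R; x \<in> carrier M\<rbrakk> \<Longrightarrow>
        (a \<otimes>\<^bsub>R\<^esub> b) \<odot>\<^bsub>M\<^esub> x = a \<odot>\<^bsub>M\<^esub> (b \<odot>\<^bsub>M\<^esub> x)"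
    and smult_one:
      "x \<in> carrier M \<Longrightarrow> \<one>\<^bsub>R\<^esub> \<odot>\<^bsub>M\<^esub> x = x"

record ('r, 'm) bimodule = "('r, 'm) module" +
  rsmult :: "'m \<Rightarrow> 'r \<Rightarrow> 'm"  (infixl \<open>\<odot>\<^sub>r\<index>\<close> 70)

locale bimodule = left_module R M
  for R :: "('r, 'p) ring_scheme" (structure) and M :: "('r, 'm, 'q) bimodule_scheme" (structure) +
  assumes rsmult_closed:
      "\<lbrakk>x \<in> carrier M; a \<in> carrier R\<rbrakk> \<Longrightarrow> x \<odot>\<^sub>r\<^bsub>M\<^esub> a \<in> carrier M"
    and rsmult_r_distr:
      "\<lbrakk>x \<in> carrier M; a \<in> carrier R; b \<in> carrier R\<rbrakk> \<Longrightarrow>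
        x \<odot>\<^sub>r\<^bsub>M\<^esub> (a \<oplus>\<^bsub>R\<^esub> b) = x \<odot>\<^sub>r\<^bsub>M\<^esub> a \<oplus>\<^bsub>M\<^esub> x \<odot>\<^sub>r\<^bsub>M\<^esub> b"
    and rsmult_l_distr:
      "\<lbrakk>x \<in> carrier M; y \<in> carrier M; a \<in> carrier R\<rbrakk> \<Longrightarrow>
        (x \<oplus>\<^bsub>M\<^esub> y) \<odot>\<^sub>r\<^bsub>M\<^esub> a = x \<odot>\<^sub>r\<^bsub>M\<^esub> a \<oplus>\<^bsub>M\<^esub> y \<odot>\<^sub>r\<^bsub>M\<^esub> a"
    and rsmult_assoc:
      "\<lbrakk>x \<in> carrier M; a \<in> carrier R; b \<in> carrier R\<rbrakk> \<Longrightarrow>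
        x \<odot>\<^sub>r\<^bsub>M\<^esub> (a \<otimes>\<^bsub>R\<^esub> b) = (x \<odot>\<^sub>r\<^bsub>M\<^esub> a) \<odot>\<^sub>r\<^bsub>M\<^esub> b"
    and rsmult_one:
      "x \<in> carrier M \<Longrightarrow> x \<odot>\<^sub>r\<^bsub>M\<^esub> \<one>\<^bsub>R\<^esub> = x"
    and smult_rsmult:
      "\<lbrakk>a \<in> carrier R; x \<in> carrier M; b \<in> carrier R\<rbrakk> \<Longrightarrow>
        (a \<odot>\<^bsub>M\<^esub> x) \<odot>\<^sub>r\<^bsub>M\<^esub> b = a \<odot>\<^bsub>M\<^esub> (x \<odot>\<^sub>r\<^bsub>M\<^esub> b)"

definition lmod_hom ::
  "('r, 'p) ring_scheme \<Rightarrow> ('r, 'm, 'q) module_scheme \<Rightarrow> ('r, 'n, 'o) module_scheme \<Rightarrow> ('m \<Rightarrow> 'n) set"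
  where "lmod_hom R M N = {f \<in> carrier M \<rightarrow> carrier N.
    (\<forall>x\<in>carrier M. \<forall>y\<in>carrier M. f (x \<oplus>\<^bsub>M\<^esub> y) = f x \<oplus>\<^bsub>N\<^esub> f y) \<and>
    (\<forall>a\<in>carrier R. \<forall>x\<in>carrier M. f (a \<odot>\<^bsub>M\<^esub> x) = a \<odot>\<^bsub>N\<^esub> f x)}"

definition bimod_hom ::
  "('r, 'p) ring_scheme \<Rightarrow> ('r, 'm, 'q) bimodule_scheme \<Rightarrow> ('r, 'n, 'o) bimodule_scheme \<Rightarrow> ('m \<Rightarrow> 'n) set"
  where "bimod_hom R M N = {f \<in> lmod_hom R M N.
    \<forall>a\<in>carrier R. \<forall>x\<in>carrier M. f (x \<odot>\<^sub>r\<^bsub>M\<^esub> a) = f x \<odot>\<^sub>r\<^bsub>N\<^esub> a}"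

definition regular_bimodule :: "('r, 'p) ring_scheme \<Rightarrow> ('r, 'r) bimodule"
  where "regular_bimodule R =
    \<lparr>carrier = carrier R, monoid.mult = monoid.mult R, monoid.one = \<one>\<^bsub>R\<^esub>, ring.zero = \<zero>\<^bsub>R\<^esub>, ring.add = ring.add R,
     smult = monoid.mult R, rsmult = monoid.mult R\<rparr>"


section \<open>Tensor products over a noncommutative ring\<close>

text \<open>\<open>M \<otimes>\<^sub>R N\<close> is the free abelian group on \<open>M \<times> N\<close> modulo the subgroup generated by
  the biadditivity and \<open>R\<close>-balancing relations; its elements are cosets.\<close>

type_synonym ('m, 'n) tensor = "('m \<times> 'n \<Rightarrow>\<^sub>0 int) set"

definition tensor_free ::
  "('r, 'm, 'p) module_scheme \<Rightarrow> ('r, 'n, 'q) module_scheme \<Rightarrow> ('m \<times> 'n \<Rightarrow>\<^sub>0 int) monoid"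
  where "tensor_free M N = free_Abelian_group (carrier M \<times> carrier N)"

definition tensor_rels ::
  "('r, 'o) ring_scheme \<Rightarrow> ('r, 'm, 'p) bimodule_scheme \<Rightarrow> ('r, 'n, 'q) module_scheme \<Rightarrow>
    ('m \<times> 'n \<Rightarrow>\<^sub>0 int) set"
  where "tensor_rels R M N = generate (tensor_free M N)
    ({frag_of (x \<oplus>\<^bsub>M\<^esub> x', y) - frag_of (x, y) - frag_of (x', y) | x x' y.
        x \<in> carrier M \<and> x' \<in> carrier M \<and> y \<in> carrier N} \<union>
     {frag_of (x, y \<oplus>\<^bsub>N\<^esub> y') - frag_of (x, y) - frag_of (x, y') | x y y'.
        x \<in> carrier M \<and> y \<in> carrier N \<and> y' \<in> carrier N} \<union>
     {frag_of (x \<odot>\<^sub>r\<^bsub>M\<^esub> a, y) - frag_of (x, a \<odot>\<^bsub>N\<^esub> y) | x a y.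
        x \<in> carrier M \<and> a \<in> carrier R \<and> y \<in> carrier N})"

definition ptensor ::
  "('r, 'o) ring_scheme \<Rightarrow> ('r, 'm, 'p) bimodule_scheme \<Rightarrow> ('r, 'n, 'q) module_scheme \<Rightarrow>
    'm \<Rightarrow> 'n \<Rightarrow> ('m, 'n) tensor"
  where "ptensor R M N x y = tensor_rels R M N #>\<^bsub>tensor_free M N\<^esub> frag_of (x, y)"

text \<open>The additive map out of a tensor product determined by \<open>x \<otimes> y \<mapsto> f (x, y)\<close>,
  meaningful when \<open>f\<close> is biadditive and \<open>R\<close>-balanced: the set below is then a singleton.\<close>

definition tensor_lift ::
  "('a, 'p) ring_scheme \<Rightarrow> ('m \<times> 'n \<Rightarrow> 'a) \<Rightarrow> ('m, 'n) tensor \<Rightarrow> 'a"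
  where "tensor_lift A f t = the_elem
    ((\<lambda>z. \<Oplus>\<^bsub>A\<^esub>p\<in>Poly_Mapping.keys z. [Poly_Mapping.lookup z p] \<cdot>\<^bsub>A\<^esub> f p) ` t)"

definition tensor_group ::
  "('r, 'o) ring_scheme \<Rightarrow> ('r, 'm, 'p) bimodule_scheme \<Rightarrow> ('r, 'n, 'q) module_scheme \<Rightarrow>
    ('m, 'n) tensor ring"
  where "tensor_group R M N =
    \<lparr>carrier = carrier (tensor_free M N Mod tensor_rels R M N),
     monoid.mult = undefined, monoid.one = undefined,
     ring.zero = monoid.one (tensor_free M N Mod tensor_rels R M N),
     ring.add = monoid.mult (tensor_free M N Mod tensor_rels R M N)\<rparr>"

definition tensor ::
  "('r, 'o) ring_scheme \<Rightarrow> ('r, 'm, 'p) bimodule_scheme \<Rightarrow> ('r, 'n, 'q) module_scheme \<Rightarrow>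
    ('r, ('m, 'n) tensor) module"
  where "tensor R M N = ring.extend (tensor_group R M N)
    \<lparr>smult = (\<lambda>a. tensor_lift (tensor_group R M N) (\<lambda>(x, y). ptensor R M N (a \<odot>\<^bsub>M\<^esub> x) y))\<rparr>"

definition tensor_bimodule ::
  "('r, 'o) ring_scheme \<Rightarrow> ('r, 'm, 'p) bimodule_scheme \<Rightarrow> ('r, 'n, 'q) bimodule_scheme \<Rightarrow>
    ('r, ('m, 'n) tensor) bimodule"
  where "tensor_bimodule R M N = module.extend (tensor R M N)
    \<lparr>rsmult = (\<lambda>t a. tensor_lift (tensor_group R M N) (\<lambda>(x, y). ptensor R M N x (y \<odot>\<^sub>r\<^bsub>N\<^esub> a)) t)\<rparr>"

text \<open>\<open>f \<otimes> g\<close>, with codomain \<open>M' \<otimes>\<^sub>R N'\<close>.\<close>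

definition tensor_map ::
  "('r, 'o) ring_scheme \<Rightarrow> ('r, 'm2, 'p) bimodule_scheme \<Rightarrow> ('r, 'n2, 'q) module_scheme \<Rightarrow>
    ('m \<Rightarrow> 'm2) \<Rightarrow> ('n \<Rightarrow> 'n2) \<Rightarrow> ('m, 'n) tensor \<Rightarrow> ('m2, 'n2) tensor"
  where "tensor_map R M' N' f g =
    tensor_lift (tensor R M' N') (\<lambda>(x, y). ptensor R M' N' (f x) (g y))"

text \<open>The associator \<open>(L \<otimes> M) \<otimes> N \<rightarrow> L \<otimes> (M \<otimes> N)\<close> and the unitors
  \<open>R \<otimes> N \<rightarrow> N\<close> and \<open>M \<otimes> R \<rightarrow> M\<close>.\<close>

definition tensor_assoc ::
  "('r, 'o) ring_scheme \<Rightarrow> ('r, 'l, 'p) bimodule_scheme \<Rightarrow> ('r, 'm, 'q) bimodule_scheme \<Rightarrow>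
    ('r, 'n, 's) module_scheme \<Rightarrow> (('l, 'm) tensor, 'n) tensor \<Rightarrow> ('l, ('m, 'n) tensor) tensor"
  where "tensor_assoc R L M N =
    (let MN = tensor R M N; T = tensor R L MN in
      tensor_lift T (\<lambda>(t, z). tensor_lift T (\<lambda>(x, y). ptensor R L MN x (ptensor R M N y z)) t))"

definition tensor_lunit :: "('r, 'n, 'q) module_scheme \<Rightarrow> ('r, 'n) tensor \<Rightarrow> 'n"
  where "tensor_lunit N = tensor_lift N (\<lambda>(a, y). a \<odot>\<^bsub>N\<^esub> y)"

definition tensor_runit :: "('r, 'm, 'p) bimodule_scheme \<Rightarrow> ('m, 'r) tensor \<Rightarrow> 'm"
  where "tensor_runit M = tensor_lift M (\<lambda>(x, a). x \<odot>\<^sub>r\<^bsub>M\<^esub> a)"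


section \<open>Corings and comodules\<close>

record ('r, 'c) coring = "('r, 'c) bimodule" +
  comult :: "'c \<Rightarrow> ('c, 'c) tensor"
  counit :: "'c \<Rightarrow> 'r"

locale coring = bimodule R C
  for R :: "('r, 'p) ring_scheme" (structure) and C :: "('r, 'c, 'q) coring_scheme" (structure) +
  assumes comult_hom: "comult C \<in> bimod_hom R C (tensor_bimodule R C C)"
    and counit_hom: "counit C \<in> bimod_hom R C (regular_bimodule R)"
    and comult_coassoc: "c \<in> carrier C \<Longrightarrow>
      tensor_assoc R C C C (tensor_map R (tensor_bimodule R C C) C (comult C) id (comult C c))
      = tensor_map R C (tensor R C C) id (comult C) (comult C c)"
    and comult_counit_left: "c \<in> carrier C \<Longrightarrow>
      tensor_lunit C (tensor_map R (regular_bimodule R) C (counit C) id (comult C c)) = c"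
    and comult_counit_right: "c \<in> carrier C \<Longrightarrow>
      tensor_runit C (tensor_map R C (regular_bimodule R) id (counit C) (comult C c)) = c"

record ('r, 'm, 'c) comodule = "('r, 'm) module" +
  coaction :: "'m \<Rightarrow> ('c, 'm) tensor"

locale left_comodule = coring R C + M?: left_module R M
  for R :: "('r, 'p) ring_scheme" (structure) and C :: "('r, 'c, 'q) coring_scheme" (structure)
    and M :: "('r, 'm, 'c, 's) comodule_scheme" (structure) +
  assumes coaction_hom: "coaction M \<in> lmod_hom R M (tensor R C M)"
    and coaction_coassoc: "x \<in> carrier M \<Longrightarrow>
      tensor_assoc R C C M (tensor_map R (tensor_bimodule R C C) M (comult C) id (coaction M x))
      = tensor_map R C (tensor R C M) id (coaction M) (coaction M x)"
    and coaction_counit: "x \<in> carrier M \<Longrightarrow>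
      tensor_lunit M (tensor_map R (regular_bimodule R) M (counit C) id (coaction M x)) = x"

definition comod_hom ::
  "('r, 'p) ring_scheme \<Rightarrow> ('r, 'c, 'q) coring_scheme \<Rightarrow>
    ('r, 'm, 'c, 's) comodule_scheme \<Rightarrow> ('r, 'n, 'c, 't) comodule_scheme \<Rightarrow> ('m \<Rightarrow> 'n) set"
  where "comod_hom R C M N = {f \<in> lmod_hom R M N.
    \<forall>x\<in>carrier M. coaction N (f x) = tensor_map R C N id f (coaction M x)}"


section \<open>Categories, functors, representability\<close>

text \<open>Arrows do not carry their endpoints, so composition and the arrow part of a functor
  take the objects involved as arguments; \<open>Comp \<C> A B D g f\<close> is \<open>g \<circ> f\<close>
  for \<open>f : A \<rightarrow> B\<close> and \<open>g : B \<rightarrow> D\<close>.\<close>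

record ('o, 'a) cat =
  Obj :: "'o set"
  Hom :: "'o \<Rightarrow> 'o \<Rightarrow> 'a set"
  Idn :: "'o \<Rightarrow> 'a"
  Comp :: "'o \<Rightarrow> 'o \<Rightarrow> 'o \<Rightarrow> 'a \<Rightarrow> 'a \<Rightarrow> 'a"

record ('o, 'a, 'p, 'b) fctr =
  fobj :: "'o \<Rightarrow> 'p"
  fmap :: "'o \<Rightarrow> 'o \<Rightarrow> 'a \<Rightarrow> 'b"

definition is_functor :: "('o, 'a) cat \<Rightarrow> ('p, 'b) cat \<Rightarrow> ('o, 'a, 'p, 'b) fctr \<Rightarrow> bool"
  where "is_functor \<C> \<D> F \<longleftrightarrow>
    (\<forall>A\<in>Obj \<C>. fobj F A \<in> Obj \<D>) \<and>
    (\<forall>A\<in>Obj \<C>. \<forall>B\<in>Obj \<C>. \<forall>f\<in>Hom \<C> A B. fmap F A B f \<in> Hom \<D> (fobj F A) (fobj F B)) \<and>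
    (\<forall>A\<in>Obj \<C>. fmap F A A (Idn \<C> A) = Idn \<D> (fobj F A)) \<and>
    (\<forall>A\<in>Obj \<C>. \<forall>B\<in>Obj \<C>. \<forall>D\<in>Obj \<C>. \<forall>f\<in>Hom \<C> A B. \<forall>g\<in>Hom \<C> B D.
      fmap F A D (Comp \<C> A B D g f) =
        Comp \<D> (fobj F A) (fobj F B) (fobj F D) (fmap F B D g) (fmap F A B f))"

definition fcomp :: "('p, 'b, 'q, 'c) fctr \<Rightarrow> ('o, 'a, 'p, 'b) fctr \<Rightarrow> ('o, 'a, 'q, 'c) fctr"
    (infixl \<open>\<circ>\<^sub>F\<close> 55)
  where "G \<circ>\<^sub>F F = \<lparr>fobj = (\<lambda>A. fobj G (fobj F A)),
    fmap = (\<lambda>A B f. fmap G (fobj F A) (fobj F B) (fmap F A B f))\<rparr>"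

text \<open>A set-valued functor is representable if it is isomorphic to \<open>Hom \<C> A -\<close> for an object
  \<open>A\<close>. The two functors take values in sets over different types, so the natural isomorphism
  is spelled out: a family of bijections \<open>\<phi> M\<close> commuting with the actions of the arrows.\<close>

definition set_representable :: "('o, 'a) cat \<Rightarrow> ('o, 'a, 'b set, 'b \<Rightarrow> 'b) fctr \<Rightarrow> bool"
  where "set_representable \<C> P \<longleftrightarrow> (\<exists>A\<in>Obj \<C>. \<exists>\<phi>.
    (\<forall>M\<in>Obj \<C>. bij_betw (\<phi> M) (Hom \<C> A M) (fobj P M)) \<and>
    (\<forall>M\<in>Obj \<C>. \<forall>N\<in>Obj \<C>. \<forall>f\<in>Hom \<C> M N. \<forall>h\<in>Hom \<C> A M.
      \<phi> N (Comp \<C> A M N f h) = fmap P M N f (\<phi> M h)))"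

text \<open>Categories of all modules need a universe of sets. Its role is played by a collection
  \<open>\<U>\<close> of subsets of a type, over which the results are universally quantified; modules are
  those with carrier in \<open>\<U>\<close>. Only the closure under sets of at most the same size and the
  existence of an infinite member are required. These hold for a Grothendieck universe with an
  infinite member (take the universe as the type and its members as \<open>\<U>\<close>).\<close>

definition universe :: "'u set set \<Rightarrow> bool"
  where "universe \<U> \<longleftrightarrow> (\<exists>A\<in>\<U>. infinite A) \<and> (\<forall>A\<in>\<U>. \<forall>B. B \<lesssim> A \<longrightarrow> B \<in> \<U>)"

text \<open>Morphisms are extensional functions, i.e. undefined outside the carrier of the domain.\<close>

definition Mod_cat :: "'u set set \<Rightarrow> 's ring \<Rightarrow> (('s, 'u) module, 'u \<Rightarrow> 'u) cat"
  where "Mod_cat \<U> S =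
    \<lparr>Obj = {M. left_module S M \<and> carrier M \<in> \<U>},
     Hom = (\<lambda>M N. lmod_hom S M N \<inter> extensional (carrier M)),
     Idn = (\<lambda>M. restrict id (carrier M)),
     Comp = (\<lambda>L M N g f. compose (carrier L) g f)\<rparr>"

definition Comod_cat ::
  "'u set set \<Rightarrow> 'r ring \<Rightarrow> ('r, 'c) coring \<Rightarrow> (('r, 'u, 'c) comodule, 'u \<Rightarrow> 'u) cat"
  where "Comod_cat \<U> R C =
    \<lparr>Obj = {M. left_comodule R C M \<and> carrier M \<in> \<U>},
     Hom = (\<lambda>M N. comod_hom R C M N \<inter> extensional (carrier M)),
     Idn = (\<lambda>M. restrict id (carrier M)),
     Comp = (\<lambda>L M N g f. compose (carrier L) g f)\<rparr>"

definition forgetful :: "(('s, 'u) module, 'u \<Rightarrow> 'u, 'u set, 'u \<Rightarrow> 'u) fctr"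
  where "forgetful = \<lparr>fobj = carrier, fmap = (\<lambda>M N f. f)\<rparr>"

definition representable_functor ::
  "('o, 'a) cat \<Rightarrow> 'u set set \<Rightarrow> 's ring \<Rightarrow> ('o, 'a, ('s, 'u) module, 'u \<Rightarrow> 'u) fctr \<Rightarrow> bool"
  where "representable_functor \<C> \<U> S F \<longleftrightarrow>
    is_functor \<C> (Mod_cat \<U> S) F \<and> set_representable \<C> (forgetful \<circ>\<^sub>F F)"

end

theory Submission
  imports Defs
begin

text \<open>
  Let the comodule \<open>A\<close> represent \<open>F\<close> and the \<open>S\<close>-module \<open>B\<close> represent \<open>G\<close>, so that
  \<open>G (F M) \<cong> Hom\<^sub>S(B, F M)\<close> and \<open>F M \<cong> Hom(A, M)\<close> as sets. By an Eckmann-Hilton argument on the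
  biproduct \<open>A \<oplus> A\<close> the addition of \<open>F M\<close> corresponds to the pointwise addition of homomorphisms,
  and by the Yoneda lemma the action of \<open>S\<close> on \<open>F M\<close> comes from a right action of \<open>S\<close> on \<open>A\<close> by
  comodule endomorphisms. Hence \<open>Hom\<^sub>S(B, F M) \<cong> Hom(A \<otimes>\<^sub>S B, M)\<close>, and \<open>A \<otimes>\<^sub>S B\<close>, moved into the
  universe along a bijection, represents \<open>G \<circ> F\<close>. The axioms for \<open>A \<oplus> A\<close>, \<open>A \<otimes>\<^sub>S B\<close> and the moved
  comodules all follow from one principle: a module with a linear coaction is a comodule as soon as
  it is additively generated by the images of coaction-compatible maps from a comodule.
\<close>

section \<open>Additive maps and the universal property of the tensor product\<close>

text \<open>The hypotheses give bijections of bare sets, natural in M; the module structure of F M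
  is visible only through the S-linearity of the maps F f. Sums and multiples in F M must therefore
  be realised by comodule maps, and this is what forces A \<oplus> A and endomorphisms of A into the
  argument.

  When C is not flat over R, tensoring with C may destroy injectivity, and subobjects of comodules
  are hard to handle. Every comodule built here is instead of colimit type: a coproduct, a quotient
  of a sum of copies of A (one copy for each element of B), or an isomorphic copy. For such objects
  the maps coming in from a known comodule determine the coaction, and all identities can be tested
  along them.

  The constructions live on types of pairs or of cosets, whereas objects of the category live on
  \<open>'u\<close>. Membership in the universe is a matter of size alone, so a bound by an infinite
  member of \<open>\<U>\<close> is what allows a construction to be copied back to
  \<open>'u\<close>.\<close>

definition additive_map :: "('a, 'p) ring_scheme \<Rightarrow> ('b, 'q) ring_scheme \<Rightarrow> ('a \<Rightarrow> 'b) \<Rightarrow> bool"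
  where "additive_map M N f \<longleftrightarrow> f \<in> carrier M \<rightarrow> carrier N \<and>
    (\<forall>x\<in>carrier M. \<forall>y\<in>carrier M. f (x \<oplus>\<^bsub>M\<^esub> y) = f x \<oplus>\<^bsub>N\<^esub> f y)"

text \<open>Closure under negatives is phrased by the equation x + y = 0, so the notion unfolds to
  carrier, addition and zero and passes between records that share these fields.\<close>

definition generates :: "('a, 'p) ring_scheme \<Rightarrow> 'a set \<Rightarrow> bool"
  where "generates M Y \<longleftrightarrow> Y \<subseteq> carrier M \<and>
    (\<forall>H\<subseteq>carrier M. Y \<subseteq> H \<and> \<zero>\<^bsub>M\<^esub> \<in> H \<and> (\<forall>x\<in>H. \<forall>y\<in>H. x \<oplus>\<^bsub>M\<^esub> y \<in> H) \<and>
      (\<forall>x\<in>H. \<forall>y\<in>carrier M. x \<oplus>\<^bsub>M\<^esub> y = \<zero>\<^bsub>M\<^esub> \<longrightarrow> y \<in> H) \<longrightarrow> carrier M \<subseteq> H)"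

lemma additiveI:
  assumes "\<And>x. x \<in> carrier M \<Longrightarrow> f x \<in> carrier N"
    and "\<And>x y. x \<in> carrier M \<Longrightarrow> y \<in> carrier M \<Longrightarrow> f (x \<oplus>\<^bsub>M\<^esub> y) = f x \<oplus>\<^bsub>N\<^esub> f y"
  shows "additive_map M N f"
  using assms by (auto simp: additive_map_def)

lemma additive_closed: "additive_map M N f \<Longrightarrow> x \<in> carrier M \<Longrightarrow> f x \<in> carrier N"
  by (auto simp: additive_map_def)

lemma additive_add:
  "additive_map M N f \<Longrightarrow> x \<in> carrier M \<Longrightarrow> y \<in> carrier M \<Longrightarrow> f (x \<oplus>\<^bsub>M\<^esub> y) = f x \<oplus>\<^bsub>N\<^esub> f y"
  by (auto simp: additive_map_def)

lemma additive_comp: "additive_map M N f \<Longrightarrow> additive_map N L g \<Longrightarrow> additive_map M L (\<lambda>x. g (f x))"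
  by (auto simp: additive_map_def Pi_iff)

lemma additive_id: "additive_map M M (\<lambda>x. x)"
  by (auto simp: additive_map_def)

lemma additive_plus:
  assumes "abelian_group N" "additive_map M N f" "additive_map M N g"
  shows "additive_map M N (\<lambda>x. f x \<oplus>\<^bsub>N\<^esub> g x)"
proof -
  interpret N: abelian_group N by fact
  show ?thesis
    using assms by (intro additiveI) (auto simp: additive_map_def Pi_iff N.a_ac)
qed

lemma additive_zero:
  assumes "abelian_group M" "abelian_group N" "additive_map M N f"
  shows "f \<zero>\<^bsub>M\<^esub> = \<zero>\<^bsub>N\<^esub>"
proof -
  interpret M: abelian_group M by fact
  interpret N: abelian_group N by fact
  have c: "f \<zero>\<^bsub>M\<^esub> \<in> carrier N"
    using assms(3) by (simp add: additive_closed)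
  have "f \<zero>\<^bsub>M\<^esub> \<oplus>\<^bsub>N\<^esub> f \<zero>\<^bsub>M\<^esub> = f \<zero>\<^bsub>M\<^esub> \<oplus>\<^bsub>N\<^esub> \<zero>\<^bsub>N\<^esub>"
    using additive_add[OF assms(3), of "\<zero>\<^bsub>M\<^esub>" "\<zero>\<^bsub>M\<^esub>"] c by simp
  then show ?thesis
    using c by (metis N.add.l_cancel N.zero_closed)
qed

text \<open>The set where two additive maps agree is a subgroup. Identities on tensor products and
  on generated comodules are reduced to generators by this rule.\<close>

lemma additive_eqI:
  assumes gen: "generates M Y" and M: "abelian_group M" and N: "abelian_group N"
    and f: "additive_map M N f" and g: "additive_map M N g"
    and eq: "\<And>x. x \<in> Y \<Longrightarrow> f x = g x" and x: "x \<in> carrier M"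
  shows "f x = g x"
proof -
  interpret M: abelian_group M by fact
  interpret N: abelian_group N by fact
  let ?H = "{x \<in> carrier M. f x = g x}"
  have "y \<in> ?H" if x: "x \<in> ?H" and y: "y \<in> carrier M" "x \<oplus>\<^bsub>M\<^esub> y = \<zero>\<^bsub>M\<^esub>" for x y
  proof -
    have "f x \<oplus>\<^bsub>N\<^esub> f y = f x \<oplus>\<^bsub>N\<^esub> g y"
      using x y additive_add[OF f, of x y] additive_add[OF g, of x y]
        additive_zero[OF M N f] additive_zero[OF M N g] by simp
    then show ?thesis
      using x y additive_closed[OF f] additive_closed[OF g] by simp
  qed
  moreover have "Y \<subseteq> ?H"
    using gen eq by (auto simp: generates_def)
  moreover have "\<zero>\<^bsub>M\<^esub> \<in> ?H"
    using additive_zero[OF M N f] additive_zero[OF M N g] by simp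
  moreover have "\<forall>x\<in>?H. \<forall>y\<in>?H. x \<oplus>\<^bsub>M\<^esub> y \<in> ?H"
    using f g by (auto simp: additive_add)
  ultimately have "carrier M \<subseteq> ?H"
    using gen unfolding generates_def by (metis (no_types, lifting) mem_Collect_eq subsetI)
  then show ?thesis
    using x by auto
qed

section \<open>Linear maps and balanced maps\<close>

text \<open>Right linearity is what a map needs in order to act on the left factor of a tensor
  product; \<open>id\<close>, \<open>comult\<close> and \<open>counit\<close> are used in this
  role.\<close>

definition rmod_hom ::
  "('r, 'p) ring_scheme \<Rightarrow> ('r, 'm, 'q) bimodule_scheme \<Rightarrow> ('r, 'n, 'o) bimodule_scheme \<Rightarrow> ('m \<Rightarrow> 'n) set"
  where "rmod_hom R M N = {f. additive_map M N f \<and>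
    (\<forall>a\<in>carrier R. \<forall>x\<in>carrier M. f (x \<odot>\<^sub>r\<^bsub>M\<^esub> a) = f x \<odot>\<^sub>r\<^bsub>N\<^esub> a)}"

lemma lmod_hom_additive: "f \<in> lmod_hom R M N \<Longrightarrow> additive_map M N f"
  by (auto simp: lmod_hom_def additive_map_def)

lemma lmod_hom_smult:
  "f \<in> lmod_hom R M N \<Longrightarrow> a \<in> carrier R \<Longrightarrow> x \<in> carrier M \<Longrightarrow> f (a \<odot>\<^bsub>M\<^esub> x) = a \<odot>\<^bsub>N\<^esub> f x"
  by (auto simp: lmod_hom_def)

lemma lmod_homI:
  "additive_map M N f \<Longrightarrow> (\<And>a x. a \<in> carrier R \<Longrightarrow> x \<in> carrier M \<Longrightarrow> f (a \<odot>\<^bsub>M\<^esub> x) = a \<odot>\<^bsub>N\<^esub> f x)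
    \<Longrightarrow> f \<in> lmod_hom R M N"
  by (auto simp: lmod_hom_def additive_map_def)

lemma lmod_hom_closed: "f \<in> lmod_hom R M N \<Longrightarrow> x \<in> carrier M \<Longrightarrow> f x \<in> carrier N"
  by (auto simp: lmod_hom_def)

lemma lmod_hom_add:
  "f \<in> lmod_hom R M N \<Longrightarrow> x \<in> carrier M \<Longrightarrow> y \<in> carrier M \<Longrightarrow> f (x \<oplus>\<^bsub>M\<^esub> y) = f x \<oplus>\<^bsub>N\<^esub> f y"
  by (auto simp: lmod_hom_def)

lemma lmod_hom_comp: "f \<in> lmod_hom R M N \<Longrightarrow> g \<in> lmod_hom R N L \<Longrightarrow> (\<lambda>x. g (f x)) \<in> lmod_hom R M L"
  by (auto simp: lmod_hom_def Pi_iff)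

lemma lmod_hom_id: "(\<lambda>x. x) \<in> lmod_hom R M M" "id \<in> lmod_hom R M M"
  by (auto simp: lmod_hom_def)

lemma rmod_hom_additive: "f \<in> rmod_hom R M N \<Longrightarrow> additive_map M N f"
  by (auto simp: rmod_hom_def)

lemma rmod_hom_rsmult:
  "f \<in> rmod_hom R M N \<Longrightarrow> a \<in> carrier R \<Longrightarrow> x \<in> carrier M \<Longrightarrow> f (x \<odot>\<^sub>r\<^bsub>M\<^esub> a) = f x \<odot>\<^sub>r\<^bsub>N\<^esub> a"
  by (auto simp: rmod_hom_def)

lemma rmod_hom_id: "id \<in> rmod_hom R M M"
  by (auto simp: rmod_hom_def additive_map_def)

lemma bimod_hom_rmod_hom: "f \<in> bimod_hom R M N \<Longrightarrow> f \<in> rmod_hom R M N"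
  by (auto simp: rmod_hom_def bimod_hom_def lmod_hom_additive)

text \<open>One clause for each of the three families of generators of
  \<open>tensor_rels\<close>.\<close>

definition balanced ::
  "('r, 'o) ring_scheme \<Rightarrow> ('r, 'm, 'p) bimodule_scheme \<Rightarrow> ('r, 'n, 'q) module_scheme \<Rightarrow>
    ('a, 's) ring_scheme \<Rightarrow> ('m \<times> 'n \<Rightarrow> 'a) \<Rightarrow> bool"
  where "balanced R M N A f \<longleftrightarrow>
    (\<forall>y\<in>carrier N. additive_map M A (\<lambda>x. f (x, y))) \<and>
    (\<forall>x\<in>carrier M. additive_map N A (\<lambda>y. f (x, y))) \<and>
    (\<forall>x\<in>carrier M. \<forall>a\<in>carrier R. \<forall>y\<in>carrier N. f (x \<odot>\<^sub>r\<^bsub>M\<^esub> a, y) = f (x, a \<odot>\<^bsub>N\<^esub> y))"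

lemma balancedI:
  assumes "\<And>y. y \<in> carrier N \<Longrightarrow> additive_map M A (\<lambda>x. f (x, y))"
    and "\<And>x. x \<in> carrier M \<Longrightarrow> additive_map N A (\<lambda>y. f (x, y))"
    and "\<And>x a y. x \<in> carrier M \<Longrightarrow> a \<in> carrier R \<Longrightarrow> y \<in> carrier N \<Longrightarrow>
      f (x \<odot>\<^sub>r\<^bsub>M\<^esub> a, y) = f (x, a \<odot>\<^bsub>N\<^esub> y)"
  shows "balanced R M N A f"
  using assms by (auto simp: balanced_def)

section \<open>The universal property of the tensor product\<close>

text \<open>Of the scalars only closure is asked, so the locale covers bimodules over R and also
  \<open>with_right_action\<close>, where the right scalars are a family of endomorphisms.\<close>

locale tensor_pair =
  fixes R :: "('r, 'o) ring_scheme" and M :: "('r, 'm, 'p) bimodule_scheme"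
    and N :: "('r, 'n, 'q) module_scheme"
  assumes left_abelian: "abelian_group M" and right_abelian: "abelian_group N"
    and rsmult_closed': "x \<in> carrier M \<Longrightarrow> a \<in> carrier R \<Longrightarrow> x \<odot>\<^sub>r\<^bsub>M\<^esub> a \<in> carrier M"
    and smult_closed': "a \<in> carrier R \<Longrightarrow> y \<in> carrier N \<Longrightarrow> a \<odot>\<^bsub>N\<^esub> y \<in> carrier N"
begin

interpretation M: abelian_group M by (rule left_abelian)
interpretation N: abelian_group N by (rule right_abelian)

abbreviation "T \<equiv> tensor_group R M N"

definition relators :: "('m \<times> 'n \<Rightarrow>\<^sub>0 int) set"
  where "relators =
    {frag_of (x \<oplus>\<^bsub>M\<^esub> x', y) - frag_of (x, y) - frag_of (x', y) | x x' y.
        x \<in> carrier M \<and> x' \<in> carrier M \<and> y \<in> carrier N} \<union>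
     {frag_of (x, y \<oplus>\<^bsub>N\<^esub> y') - frag_of (x, y) - frag_of (x, y') | x y y'.
        x \<in> carrier M \<and> y \<in> carrier N \<and> y' \<in> carrier N} \<union>
     {frag_of (x \<odot>\<^sub>r\<^bsub>M\<^esub> a, y) - frag_of (x, a \<odot>\<^bsub>N\<^esub> y) | x a y.
        x \<in> carrier M \<and> a \<in> carrier R \<and> y \<in> carrier N}"

lemma rels_eq: "tensor_rels R M N = generate (tensor_free M N) relators"
  by (simp add: tensor_rels_def relators_def)

lemma free_comm_group: "comm_group (tensor_free M N)"
  by (simp add: tensor_free_def abelian_free_Abelian_group)

interpretation F: comm_group "tensor_free M N" by (rule free_comm_group)

lemma free_frag_of [simp]:
  "frag_of (x, y) \<in> carrier (tensor_free M N) \<longleftrightarrow> x \<in> carrier M \<and> y \<in> carrier N"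
  by (simp add: tensor_free_def)

lemma free_diff:
  "a \<in> carrier (tensor_free M N) \<Longrightarrow> b \<in> carrier (tensor_free M N) \<Longrightarrow> a - b \<in> carrier (tensor_free M N)"
  using keys_diff[of a b] by (auto simp: tensor_free_def)

lemma free_mult [simp]: "a \<otimes>\<^bsub>tensor_free M N\<^esub> b = a + b"
  by (simp add: tensor_free_def)

lemma free_one [simp]: "\<one>\<^bsub>tensor_free M N\<^esub> = 0"
  by (simp add: tensor_free_def)

lemma relators_subset: "relators \<subseteq> carrier (tensor_free M N)"
  unfolding relators_def by (auto intro!: free_diff simp: rsmult_closed' smult_closed')

lemma rels_subgroup: "subgroup (tensor_rels R M N) (tensor_free M N)"
  unfolding rels_eq by (rule F.generate_is_subgroup[OF relators_subset])

lemma rels_normal: "tensor_rels R M N \<lhd> tensor_free M N"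
  by (rule F.subgroup_imp_normal[OF rels_subgroup])

lemma abelian_group_tensor_group: "abelian_group T"
proof -
  interpret Q: comm_group "tensor_free M N Mod tensor_rels R M N"
    using F.abelian_FactGroup[OF rels_subgroup] .
  show ?thesis
    unfolding tensor_group_def
    by (rule abelian_groupI; simp only: partial_object.simps monoid.simps ring.simps)
      (rule Q.m_closed Q.one_closed Q.m_assoc Q.m_comm Q.l_one Q.l_inv_ex; assumption)+
qed

definition proj where "proj z = tensor_rels R M N #>\<^bsub>tensor_free M N\<^esub> z"

lemma ptensor_proj: "ptensor R M N x y = proj (frag_of (x, y))"
  by (simp add: proj_def ptensor_def)

lemma proj_closed: "z \<in> carrier (tensor_free M N) \<Longrightarrow> proj z \<in> carrier T"
  by (auto simp: tensor_group_def proj_def FactGroup_def RCOSETS_def)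

lemma proj_surj: assumes "t \<in> carrier T" obtains z where "z \<in> carrier (tensor_free M N)" "t = proj z"
  using assms by (auto simp: tensor_group_def proj_def FactGroup_def RCOSETS_def)

lemma proj_add:
  "z \<in> carrier (tensor_free M N) \<Longrightarrow> w \<in> carrier (tensor_free M N) \<Longrightarrow> proj (z + w) = proj z \<oplus>\<^bsub>T\<^esub> proj w"
  using normal.rcos_sum[OF rels_normal, of z w]
  by (simp add: proj_def tensor_group_def FactGroup_def)

lemma proj_eqI:
  assumes z: "z \<in> carrier (tensor_free M N)" "w \<in> carrier (tensor_free M N)" and zw: "z - w \<in>
      tensor_rels R M N"
  shows "proj z = proj w"
proof -
  have "z = (z - w) \<otimes>\<^bsub>tensor_free M N\<^esub> w" by simp
  then have "z \<in> tensor_rels R M N #>\<^bsub>tensor_free M N\<^esub> w"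
    using zw by (metis F.rcosI rels_subgroup subgroup.subset z(2))
  then show ?thesis
    unfolding proj_def using F.repr_independence[OF _ z(2) rels_subgroup] by simp
qed

lemma relators_rels: "z \<in> relators \<Longrightarrow> z \<in> tensor_rels R M N"
  unfolding rels_eq by (rule generate.incl)

lemma ptensor_closed: "x \<in> carrier M \<Longrightarrow> y \<in> carrier N \<Longrightarrow> ptensor R M N x y \<in> carrier T"
  by (simp add: ptensor_proj proj_closed)

lemma ptensor_add_left:
  assumes "x \<in> carrier M" "x' \<in> carrier M" "y \<in> carrier N"
  shows "ptensor R M N (x \<oplus>\<^bsub>M\<^esub> x') y = ptensor R M N x y \<oplus>\<^bsub>T\<^esub> ptensor R M N x' y"
proof -
  have c: "frag_of (x \<oplus>\<^bsub>M\<^esub> x', y) \<in> carrier (tensor_free M N)" "frag_of (x, y) \<in> carrier (tensor_free M N)"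
    "frag_of (x', y) \<in> carrier (tensor_free M N)"
    using assms by simp_all
  have "proj (frag_of (x \<oplus>\<^bsub>M\<^esub> x', y)) = proj (frag_of (x, y) + frag_of (x', y))"
  proof (rule proj_eqI)
    show "frag_of (x \<oplus>\<^bsub>M\<^esub> x', y) - (frag_of (x, y) + frag_of (x', y)) \<in> tensor_rels R M N"
      using assms by (intro relators_rels) (auto simp: relators_def diff_diff_eq)
  qed (use c F.m_closed[OF c(2,3)] in auto)
  then show ?thesis
    using c by (simp add: ptensor_proj proj_add)
qed

lemma ptensor_add_right:
  assumes "x \<in> carrier M" "y \<in> carrier N" "y' \<in> carrier N"
  shows "ptensor R M N x (y \<oplus>\<^bsub>N\<^esub> y') = ptensor R M N x y \<oplus>\<^bsub>T\<^esub> ptensor R M N x y'"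
proof -
  have c: "frag_of (x, y \<oplus>\<^bsub>N\<^esub> y') \<in> carrier (tensor_free M N)" "frag_of (x, y) \<in> carrier (tensor_free M N)"
    "frag_of (x, y') \<in> carrier (tensor_free M N)"
    using assms by simp_all
  have "proj (frag_of (x, y \<oplus>\<^bsub>N\<^esub> y')) = proj (frag_of (x, y) + frag_of (x, y'))"
  proof (rule proj_eqI)
    show "frag_of (x, y \<oplus>\<^bsub>N\<^esub> y') - (frag_of (x, y) + frag_of (x, y')) \<in> tensor_rels R M N"
      using assms by (intro relators_rels) (auto simp: relators_def diff_diff_eq)
  qed (use c F.m_closed[OF c(2,3)] in auto)
  then show ?thesis
    using c by (simp add: ptensor_proj proj_add)
qed

lemma ptensor_balanced:
  assumes "x \<in> carrier M" "a \<in> carrier R" "y \<in> carrier N"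
  shows "ptensor R M N (x \<odot>\<^sub>r\<^bsub>M\<^esub> a) y = ptensor R M N x (a \<odot>\<^bsub>N\<^esub> y)"
  unfolding ptensor_proj using assms
  by (intro proj_eqI relators_rels) (auto simp: relators_def rsmult_closed' smult_closed')

text \<open>The projections of the basis elements of the free group are the pure tensors, so this is
  induction on the free abelian group carried through \<open>proj\<close>.\<close>

lemma generates_ptensor: "generates T {ptensor R M N x y | x y. x \<in> carrier M \<and> y \<in> carrier N}"
  unfolding generates_def
proof (intro conjI allI impI)
  interpret T: abelian_group T by (rule abelian_group_tensor_group)
  let ?Y = "{ptensor R M N x y | x y. x \<in> carrier M \<and> y \<in> carrier N}"
  show "?Y \<subseteq> carrier T" by (auto intro: ptensor_closed)
  fix H assume H: "H \<subseteq> carrier T"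
    "?Y \<subseteq> H \<and> \<zero>\<^bsub>T\<^esub> \<in> H \<and> (\<forall>x\<in>H. \<forall>y\<in>H. x \<oplus>\<^bsub>T\<^esub> y \<in> H) \<and>
      (\<forall>x\<in>H. \<forall>y\<in>carrier T. x \<oplus>\<^bsub>T\<^esub> y = \<zero>\<^bsub>T\<^esub> \<longrightarrow> y \<in> H)"
  have z: "proj 0 = \<zero>\<^bsub>T\<^esub>"
  proof -
    have c: "0 \<in> carrier (tensor_free M N)" using F.one_closed by simp
    have "proj 0 \<oplus>\<^bsub>T\<^esub> proj 0 = proj 0" using proj_add[OF c c] by simp
    then show ?thesis using proj_closed[OF c] by (metis T.add.l_cancel_one')
  qed
  have "proj z \<in> H" if "z \<in> carrier (tensor_free M N)" for z
  proof -
    have "Poly_Mapping.keys z \<subseteq> carrier M \<times> carrier N"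
      using that by (simp add: tensor_free_def)
    then show ?thesis
    proof (rule free_Abelian_group_induct[where P = "\<lambda>z. z \<in> carrier (tensor_free M N) \<and> proj z \<in> H",
        THEN conjunct2])
      show "0 \<in> carrier (tensor_free M N) \<and> proj 0 \<in> H"
        using z H F.one_closed by simp
      show "frag_of a \<in> carrier (tensor_free M N) \<and> proj (frag_of a) \<in> H" if "a \<in> carrier M \<times> carrier N" for a
        using that H by (cases a) (auto simp: ptensor_proj)
      fix x y :: "'m \<times> 'n \<Rightarrow>\<^sub>0 int"
      assume k: "Poly_Mapping.keys x \<subseteq> carrier M \<times> carrier N" "Poly_Mapping.keys y \<subseteq> carrier M \<times> carrier N"
        "x \<in> carrier (tensor_free M N) \<and> proj x \<in> H" "y \<in> carrier (tensor_free M N) \<and> proj y \<in> H"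
      have d: "x - y \<in> carrier (tensor_free M N)" using k free_diff by simp
      have m: "0 - y \<in> carrier (tensor_free M N)" using k free_diff[of 0 y] F.one_closed by simp
      \<comment> \<open>The induction rule asks for differences, while \<open>H\<close> is closed
        under sums and under solutions of x + y = 0; the class of \<open>- y\<close> is therefore
        obtained first.\<close>
      have "proj y \<oplus>\<^bsub>T\<^esub> proj (0 - y) = \<zero>\<^bsub>T\<^esub>"
        using proj_add[of y "0 - y"] k m z by simp
      then have "proj (0 - y) \<in> H" using H k proj_closed[OF m] by blast
      then have "proj (x + (0 - y)) \<in> H"
        using proj_add[of x "0 - y"] k m H by simp
      then show "x - y \<in> carrier (tensor_free M N) \<and> proj (x - y) \<in> H"
        using d by simp
    qed
  qed
  then show "carrier T \<subseteq> H"
    by (auto elim: proj_surj)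
qed

lemma tensor_eqI:
  assumes "abelian_group A" "additive_map T A f" "additive_map T A g"
    and "\<And>x y. x \<in> carrier M \<Longrightarrow> y \<in> carrier N \<Longrightarrow> f (ptensor R M N x y) = g (ptensor R M N x y)"
    and "t \<in> carrier T"
  shows "f t = g t"
  by (rule additive_eqI[OF generates_ptensor abelian_group_tensor_group assms(1-3) _ assms(5)])
    (use assms(4) in auto)

text \<open>The homomorphism \<open>h\<close> extending f to the free group kills every relator,
  because f is balanced, and so is constant on cosets. The finite sum in \<open>tensor_lift\<close>
  computes \<open>h\<close>, hence it takes one single value on each coset, and
  \<open>the_elem\<close> returns it.\<close>

lemma tensor_lift_proj:
  assumes A: "abelian_group A" and f: "balanced R M N A f"
  obtains h where "h \<in> hom (tensor_free M N) (add_monoid A)"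
    "\<And>x y. x \<in> carrier M \<Longrightarrow> y \<in> carrier N \<Longrightarrow> h (frag_of (x, y)) = f (x, y)"
    "\<And>z. z \<in> carrier (tensor_free M N) \<Longrightarrow> tensor_lift A f (proj z) = h z"
proof -
  interpret A: abelian_group A by (rule A)
  have fc: "f (x, y) \<in> carrier A" if "x \<in> carrier M" "y \<in> carrier N" for x y
    using f that by (auto simp: balanced_def additive_map_def)
  then have "f ` (carrier M \<times> carrier N) \<subseteq> carrier (add_monoid A)" by auto
  then obtain h where h: "h \<in> hom (tensor_free M N) (add_monoid A)"
    and hf: "\<And>p. p \<in> carrier M \<times> carrier N \<Longrightarrow> h (frag_of p) = f p"
    unfolding tensor_free_def by (rule A.a_comm_group[THEN comm_group.free_Abelian_group_universal]) blast
  interpret h: group_hom "tensor_free M N" "add_monoid A" h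
    using h by (simp add: group_hom_def group_hom_axioms_def F.is_group A.a_group)
  let ?e = "\<lambda>z. \<Oplus>\<^bsub>A\<^esub>p\<in>Poly_Mapping.keys z. [Poly_Mapping.lookup z p] \<cdot>\<^bsub>A\<^esub> f p"
  \<comment> \<open>The universal property yields \<open>h\<close> abstractly; here it is identified
    with the explicit sum that occurs in \<open>tensor_lift\<close>.\<close>
  have e: "h z = ?e z" if z: "z \<in> carrier (tensor_free M N)" for z
  proof -
    have k: "Poly_Mapping.keys z \<subseteq> carrier M \<times> carrier N" using z by (simp add: tensor_free_def)
    have fr: "frag_cmul c (frag_of p) \<in> carrier (tensor_free M N)"
      "h (frag_cmul c (frag_of p)) = [c] \<cdot>\<^bsub>A\<^esub> f p" if "p \<in> carrier M \<times> carrier N" for c p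
    proof -
      have p: "frag_of p \<in> carrier (tensor_free M N)" using that by (cases p) simp
      have "frag_cmul c (frag_of p) = frag_of p [^]\<^bsub>tensor_free M N\<^esub> c"
        using that by (simp add: tensor_free_def)
      then show "frag_cmul c (frag_of p) \<in> carrier (tensor_free M N)"
        "h (frag_cmul c (frag_of p)) = [c] \<cdot>\<^bsub>A\<^esub> f p"
        using p that by (simp_all add: h.hom_int_pow hf add_pow_def del: free_mult)
    qed
    \<comment> \<open>The coefficients are an arbitrary family \<open>c\<close>, detached from
      \<open>z\<close>: the induction runs over finite sets of basis elements and is instantiated
      with the keys of \<open>z\<close> at the end.\<close>
    have sum: "finite K \<Longrightarrow> K \<subseteq> carrier M \<times> carrier N \<Longrightarrow>
      (\<Sum>p\<in>K. frag_cmul (c p) (frag_of p)) \<in> carrier (tensor_free M N) \<and>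
      h (\<Sum>p\<in>K. frag_cmul (c p) (frag_of p)) = (\<Oplus>\<^bsub>A\<^esub>p\<in>K. [c p] \<cdot>\<^bsub>A\<^esub> f p)" for K c
    proof (induction K rule: finite_induct)
      case empty
      then show ?case using h.hom_one F.one_closed by simp
    next
      case (insert p K)
      then have IH: "(\<Sum>p\<in>K. frag_cmul (c p) (frag_of p)) \<in> carrier (tensor_free M N)"
        "h (\<Sum>p\<in>K. frag_cmul (c p) (frag_of p)) = (\<Oplus>\<^bsub>A\<^esub>p\<in>K. [c p] \<cdot>\<^bsub>A\<^esub> f p)" by auto
      have "(\<lambda>p. [c p] \<cdot>\<^bsub>A\<^esub> f p) \<in> insert p K \<rightarrow> carrier A"
        using insert.prems fc by auto
      then show ?case
        using insert IH fr[of p "c p"] F.m_closed[OF fr(1)[of p "c p"] IH(1)] h.hom_mult[OF fr(1)[of p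
            "c p"] IH(1)]
        by (simp add: A.finsum_insert Pi_iff)
    qed
    have "z = (\<Sum>p\<in>Poly_Mapping.keys z. frag_cmul (Poly_Mapping.lookup z p) (frag_of p))"
      using frag_expansion[of z] by (simp add: frag_extend_def)
    then show ?thesis
      using sum[OF finite_keys k, of "Poly_Mapping.lookup z"] by simp
  qed
  have rel: "h w = \<zero>\<^bsub>A\<^esub>" if "w \<in> relators" for w
  proof -
    have diff: "h (a - b) = h a \<ominus>\<^bsub>A\<^esub> h b"
      if "a \<in> carrier (tensor_free M N)" "b \<in> carrier (tensor_free M N)" for a b
    proof -
      have "h a = h (a - b) \<oplus>\<^bsub>A\<^esub> h b"
        using h.hom_mult[OF free_diff[OF that] that(2)] by simp
      then show ?thesis
        using that h.hom_closed free_diff by (simp add: A.minus_eq A.a_assoc A.r_neg)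
    qed
    have cancel: "(u \<oplus>\<^bsub>A\<^esub> v) \<ominus>\<^bsub>A\<^esub> u \<ominus>\<^bsub>A\<^esub> v = \<zero>\<^bsub>A\<^esub>" "u \<ominus>\<^bsub>A\<^esub> u = \<zero>\<^bsub>A\<^esub>"
      if "u \<in> carrier A" "v \<in> carrier A" for u v
    proof -
      have "(u \<oplus>\<^bsub>A\<^esub> v) \<ominus>\<^bsub>A\<^esub> u = v"
        using that by (simp add: A.minus_eq A.a_comm[of u v] A.a_assoc A.r_neg)
      then show "(u \<oplus>\<^bsub>A\<^esub> v) \<ominus>\<^bsub>A\<^esub> u \<ominus>\<^bsub>A\<^esub> v = \<zero>\<^bsub>A\<^esub>" "u \<ominus>\<^bsub>A\<^esub> u = \<zero>\<^bsub>A\<^esub>"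
        using that by (simp_all add: A.minus_eq A.r_neg)
    qed
    have fl: "f (x \<oplus>\<^bsub>M\<^esub> x', y) = f (x, y) \<oplus>\<^bsub>A\<^esub> f (x', y)"
      if "x \<in> carrier M" "x' \<in> carrier M" "y \<in> carrier N" for x x' y
      using f that by (simp add: balanced_def additive_map_def)
    have fr: "f (x, y \<oplus>\<^bsub>N\<^esub> y') = f (x, y) \<oplus>\<^bsub>A\<^esub> f (x, y')"
      if "x \<in> carrier M" "y \<in> carrier N" "y' \<in> carrier N" for x y y'
      using f that by (simp add: balanced_def additive_map_def)
    have fb: "f (x \<odot>\<^sub>r\<^bsub>M\<^esub> a, y) = f (x, a \<odot>\<^bsub>N\<^esub> y)"
      if "x \<in> carrier M" "a \<in> carrier R" "y \<in> carrier N" for x a y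
      using f that by (simp add: balanced_def)
    consider x x' y where "x \<in> carrier M" "x' \<in> carrier M" "y \<in> carrier N"
        "w = frag_of (x \<oplus>\<^bsub>M\<^esub> x', y) - frag_of (x, y) - frag_of (x', y)"
      | x y y' where "x \<in> carrier M" "y \<in> carrier N" "y' \<in> carrier N"
        "w = frag_of (x, y \<oplus>\<^bsub>N\<^esub> y') - frag_of (x, y) - frag_of (x, y')"
      | x a y where "x \<in> carrier M" "a \<in> carrier R" "y \<in> carrier N"
        "w = frag_of (x \<odot>\<^sub>r\<^bsub>M\<^esub> a, y) - frag_of (x, a \<odot>\<^bsub>N\<^esub> y)"
      using \<open>w \<in> relators\<close> unfolding relators_def
      by (elim UnE CollectE exE conjE) (assumption | rule that)+
    then show ?thesis
    proof cases
      case 1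
      then show ?thesis by (simp add: diff free_diff hf fl cancel fc)
    next
      case 2
      then show ?thesis by (simp add: diff free_diff hf fr cancel(1) fc)
    next
      case 3
      then show ?thesis by (simp add: diff hf fb cancel(2)[OF fc fc] fc rsmult_closed' smult_closed')
    qed
  qed
  have ker: "h w = \<zero>\<^bsub>A\<^esub>" if "w \<in> tensor_rels R M N" for w
  proof -
    have "subgroup (kernel (tensor_free M N) (add_monoid A) h) (tensor_free M N)"
      by (rule h.subgroup_kernel)
    moreover have "relators \<subseteq> kernel (tensor_free M N) (add_monoid A) h"
      using relators_subset rel by (auto simp: kernel_def)
    ultimately have "tensor_rels R M N \<subseteq> kernel (tensor_free M N) (add_monoid A) h"
      unfolding rels_eq by (intro F.generate_subgroup_incl)
    then show ?thesis
      using that by (auto simp: kernel_def)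
  qed
  have "tensor_lift A f (proj z) = h z" if z: "z \<in> carrier (tensor_free M N)" for z
  proof -
    have c: "w + z \<in> carrier (tensor_free M N)" "h (w + z) = h z" if "w \<in> tensor_rels R M N" for w
    proof -
      have w: "w \<in> carrier (tensor_free M N)" using that rels_subgroup subgroup.subset by blast
      show "w + z \<in> carrier (tensor_free M N)" using F.m_closed[OF w z] by simp
      show "h (w + z) = h z" using h.hom_mult[OF w z] ker[OF that] h.hom_closed[OF z] by simp
    qed
    have "proj z = {w + z | w. w \<in> tensor_rels R M N}"
      by (auto simp: proj_def r_coset_def)
    then have "?e ` proj z = h ` {w + z | w. w \<in> tensor_rels R M N}"
      by (intro image_cong) (use c(1) in \<open>auto simp del: carrier_free_Abelian_group_iff simp flip: e\<close>)
    also have "\<dots> = {h z}"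
    proof -
      have "h (0 + z) \<in> h ` {w + z | w. w \<in> tensor_rels R M N}"
        using subgroup.one_closed[OF rels_subgroup] by (intro imageI CollectI exI[of _ 0]) simp
      then show ?thesis using c(2) by auto
    qed
    finally show ?thesis by (simp add: tensor_lift_def)
  qed
  then show ?thesis
    using that[OF h] hf by simp
qed

lemma tensor_lift_additive:
  assumes A: "abelian_group A" and f: "balanced R M N A f"
  shows "additive_map T A (tensor_lift A f)"
proof -
  obtain h where h: "h \<in> hom (tensor_free M N) (add_monoid A)"
    "\<And>z. z \<in> carrier (tensor_free M N) \<Longrightarrow> tensor_lift A f (proj z) = h z"
    using tensor_lift_proj[OF A f] by metis
  show ?thesis
  proof (rule additiveI)
    fix t assume "t \<in> carrier T"
    then show "tensor_lift A f t \<in> carrier A"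
      using h by (auto elim!: proj_surj simp: hom_def)
  next
    fix s t assume "s \<in> carrier T" "t \<in> carrier T"
    then obtain z w where zw: "z \<in> carrier (tensor_free M N)" "s = proj z"
      "w \<in> carrier (tensor_free M N)" "t = proj w"
      by (meson proj_surj)
    then show "tensor_lift A f (s \<oplus>\<^bsub>T\<^esub> t) = tensor_lift A f s \<oplus>\<^bsub>A\<^esub> tensor_lift A f t"
      using F.m_closed[of z w] hom_mult[OF h(1), of z w] by (simp add: proj_add[symmetric] h(2))
  qed
qed

lemma tensor_lift_ptensor:
  assumes "abelian_group A" "balanced R M N A f" "x \<in> carrier M" "y \<in> carrier N"
  shows "tensor_lift A f (ptensor R M N x y) = f (x, y)"
  using assms tensor_lift_proj[OF assms(1,2)] by (metis free_frag_of ptensor_proj)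

end


section \<open>Module structures and functoriality of tensor products\<close>

lemma tensor_sel [simp]:
  "carrier (tensor R M N) = carrier (tensor_group R M N)"
  "ring.add (tensor R M N) = ring.add (tensor_group R M N)"
  "ring.zero (tensor R M N) = ring.zero (tensor_group R M N)"
  "carrier (tensor_bimodule R M N') = carrier (tensor_group R M N')"
  "ring.add (tensor_bimodule R M N') = ring.add (tensor_group R M N')"
  "ring.zero (tensor_bimodule R M N') = ring.zero (tensor_group R M N')"
  by (simp_all add: tensor_def tensor_bimodule_def ring.defs module.defs)

lemma tensor_smult:
  "smult (tensor R M N) a =
    tensor_lift (tensor_group R M N) (\<lambda>(x, y). ptensor R M N (a \<odot>\<^bsub>M\<^esub> x) y)"
  by (simp add: tensor_def ring.defs)

lemma tensor_bimodule_rsmult: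
  "rsmult (tensor_bimodule R M N) t a =
    tensor_lift (tensor_group R M N) (\<lambda>(x, y). ptensor R M N x (y \<odot>\<^sub>r\<^bsub>N\<^esub> a)) t"
  by (simp add: tensor_bimodule_def module.defs)

lemma abelian_group_cong:
  assumes "abelian_group M" "carrier N = carrier M" "ring.add N = ring.add M" "ring.zero N = ring.zero M"
  shows "abelian_group N"
proof -
  interpret M: abelian_group M by fact
  show ?thesis
    using M.add.l_inv_ex by (intro abelian_groupI) (simp_all add: assms(2-4) M.a_ac)
qed

lemma additive_tensor [simp]:
  "additive_map (tensor R M N) A f = additive_map (tensor_group R M N) A f"
  "additive_map (tensor_bimodule R M N') A g = additive_map (tensor_group R M N') A g"
  "additive_map A (tensor R M N) h = additive_map A (tensor_group R M N) h"
  "additive_map A (tensor_bimodule R M N') k = additive_map A (tensor_group R M N') k"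
  by (simp_all add: additive_map_def)

lemma left_module_abelian_group: "left_module R M \<Longrightarrow> abelian_group M"
  by (simp add: left_module_def)

lemma bimodule_left_module: "bimodule R M \<Longrightarrow> left_module R M"
  by (simp add: bimodule_def)

lemma smult_additive: "left_module R M \<Longrightarrow> a \<in> carrier R \<Longrightarrow> additive_map M M (\<lambda>x. a \<odot>\<^bsub>M\<^esub> x)"
  by (simp add: additiveI left_module.smult_closed left_module.smult_r_distr)

lemma rsmult_additive: "bimodule R M \<Longrightarrow> a \<in> carrier R \<Longrightarrow> additive_map M M (\<lambda>x. x \<odot>\<^sub>r\<^bsub>M\<^esub> a)"
  by (simp add: additiveI bimodule.rsmult_closed bimodule.rsmult_l_distr)

lemma tensor_pairI: "bimodule R M \<Longrightarrow> left_module R N \<Longrightarrow> tensor_pair R M N"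
  by (simp add: tensor_pair_def left_module_abelian_group[OF bimodule_left_module] left_module_abelian_group
      bimodule.rsmult_closed left_module.smult_closed)

context tensor_pair
begin

interpretation T: abelian_group T by (rule abelian_group_tensor_group)

lemma abelian_group_tensor:
  "abelian_group (tensor R M N)"
  by (rule abelian_group_cong[OF abelian_group_tensor_group]) simp_all

lemma ptensor_additive_left: "y \<in> carrier N \<Longrightarrow> additive_map M T (\<lambda>x. ptensor R M N x y)"
  by (simp add: additiveI ptensor_closed ptensor_add_left)

lemma ptensor_additive_right: "x \<in> carrier M \<Longrightarrow> additive_map N T (\<lambda>y. ptensor R M N x y)"
  by (simp add: additiveI ptensor_closed ptensor_add_right)

text \<open>The left scalars \<open>K\<close> may differ from the ring over which the tensor product
  is taken, and \<open>L\<close> is a left module on the additive group of \<open>M\<close>. The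
  commutation hypothesis makes (x, y) \<mapsto> kx \<otimes> y balanced. \<open>P\<close> is any
  record with the prescribed fields, so that the lemma serves \<open>tensor\<close> (with K = R and
  L = M) and later the comodule A \<otimes> B, whose scalars from R act through A while the tensor
  product is over S.\<close>

lemma left_module_tensor_group:
  fixes P :: "('k, ('m, 'n) tensor, 'z) module_scheme"
  assumes L: "left_module K L" "carrier L = carrier M" "ring.add L = ring.add M"
    and comm: "\<And>k x a. k \<in> carrier K \<Longrightarrow> x \<in> carrier M \<Longrightarrow> a \<in> carrier R \<Longrightarrow>
      (k \<odot>\<^bsub>L\<^esub> x) \<odot>\<^sub>r\<^bsub>M\<^esub> a = k \<odot>\<^bsub>L\<^esub> (x \<odot>\<^sub>r\<^bsub>M\<^esub> a)"
    and P: "carrier P = carrier T" "ring.add P = ring.add T" "ring.zero P = ring.zero T"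
      "\<And>k. smult P k = tensor_lift T (\<lambda>(x, y). ptensor R M N (k \<odot>\<^bsub>L\<^esub> x) y)"
  shows "left_module K P"
    and "\<And>k x y. k \<in> carrier K \<Longrightarrow> x \<in> carrier M \<Longrightarrow> y \<in> carrier N \<Longrightarrow>
      k \<odot>\<^bsub>P\<^esub> ptensor R M N x y = ptensor R M N (k \<odot>\<^bsub>L\<^esub> x) y"
proof -
  interpret L: left_module K L by (rule L)
  have Lc: "k \<odot>\<^bsub>L\<^esub> x \<in> carrier M" if "k \<in> carrier K" "x \<in> carrier M" for k x
    using that L.smult_closed L(2) by simp
  have bal: "balanced R M N T (\<lambda>(x, y). ptensor R M N (k \<odot>\<^bsub>L\<^esub> x) y)" if k: "k \<in> carrier K" for k
  proof (rule balancedI; simp only: prod.case)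
    fix y assume y: "y \<in> carrier N"
    have "additive_map M M (\<lambda>x. k \<odot>\<^bsub>L\<^esub> x)"
      using smult_additive[OF L(1) k] by (simp add: additive_map_def L(2,3))
    from additive_comp[OF this ptensor_additive_left[OF y]]
    show "additive_map M T (\<lambda>x. ptensor R M N (k \<odot>\<^bsub>L\<^esub> x) y)" .
  next
    fix x a y assume "x \<in> carrier M" "a \<in> carrier R" "y \<in> carrier N"
    then show "ptensor R M N (k \<odot>\<^bsub>L\<^esub> (x \<odot>\<^sub>r\<^bsub>M\<^esub> a)) y = ptensor R M N (k \<odot>\<^bsub>L\<^esub> x) (a \<odot>\<^bsub>N\<^esub> y)"
      using k by (simp add: comm[symmetric] ptensor_balanced Lc)
  qed (simp add: ptensor_additive_right Lc k)
  have add: "additive_map T T (smult P k)" if "k \<in> carrier K" for k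
    unfolding P by (rule tensor_lift_additive[OF T.abelian_group_axioms bal[OF that]])
  show pt: "k \<odot>\<^bsub>P\<^esub> ptensor R M N x y = ptensor R M N (k \<odot>\<^bsub>L\<^esub> x) y"
    if "k \<in> carrier K" "x \<in> carrier M" "y \<in> carrier N" for k x y
    unfolding P using tensor_lift_ptensor[OF T.abelian_group_axioms bal[OF that(1)] that(2,3)] by simp
  have PA: "abelian_group P"
    by (rule abelian_group_cong[OF abelian_group_tensor_group P(1-3)])
  show "left_module K P"
  proof (intro left_module.intro left_module_axioms.intro PA L.ring_axioms; (simp only: P(1,2))?)
    fix a x assume "a \<in> carrier K" "x \<in> carrier T"
    then show "a \<odot>\<^bsub>P\<^esub> x \<in> carrier T"
      by (rule additive_closed[OF add])
  next
    fix a x y assume "a \<in> carrier K" "x \<in> carrier T" "y \<in> carrier T"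
    then show "a \<odot>\<^bsub>P\<^esub> (x \<oplus>\<^bsub>T\<^esub> y) = a \<odot>\<^bsub>P\<^esub> x \<oplus>\<^bsub>T\<^esub> a \<odot>\<^bsub>P\<^esub> y"
      by (rule additive_add[OF add])
  next
    fix a b t assume ab: "a \<in> carrier K" "b \<in> carrier K" and t: "t \<in> carrier T"
    have d: "(a \<oplus>\<^bsub>K\<^esub> b) \<odot>\<^bsub>L\<^esub> x = a \<odot>\<^bsub>L\<^esub> x \<oplus>\<^bsub>M\<^esub> b \<odot>\<^bsub>L\<^esub> x"
      "(a \<otimes>\<^bsub>K\<^esub> b) \<odot>\<^bsub>L\<^esub> x = a \<odot>\<^bsub>L\<^esub> (b \<odot>\<^bsub>L\<^esub> x)" if "x \<in> carrier M" for x
      using L.smult_l_distr[of a b x] L.smult_assoc[of a b x] ab that by (simp_all add: L(2,3))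
    show "(a \<oplus>\<^bsub>K\<^esub> b) \<odot>\<^bsub>P\<^esub> t = a \<odot>\<^bsub>P\<^esub> t \<oplus>\<^bsub>T\<^esub> b \<odot>\<^bsub>P\<^esub> t"
      by (rule tensor_eqI[OF T.abelian_group_axioms add[of "a \<oplus>\<^bsub>K\<^esub> b"]
            additive_plus[OF T.abelian_group_axioms add[of a] add[of b]] _ t])
        (use ab in \<open>simp_all add: pt Lc ptensor_add_left d\<close>)
    show "(a \<otimes>\<^bsub>K\<^esub> b) \<odot>\<^bsub>P\<^esub> t = a \<odot>\<^bsub>P\<^esub> (b \<odot>\<^bsub>P\<^esub> t)"
      by (rule tensor_eqI[OF T.abelian_group_axioms add[of "a \<otimes>\<^bsub>K\<^esub> b"] additive_comp[OF add[of b] add[of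
          a]] _ t])
        (use ab in \<open>simp_all add: pt Lc d\<close>)
  next
    fix t assume t: "t \<in> carrier T"
    have "\<one>\<^bsub>K\<^esub> \<odot>\<^bsub>L\<^esub> x = x" if "x \<in> carrier M" for x
      using L.smult_one[of x] that by (simp add: L(2))
    then show "\<one>\<^bsub>K\<^esub> \<odot>\<^bsub>P\<^esub> t = t"
      by (intro tensor_eqI[OF T.abelian_group_axioms add[of "\<one>\<^bsub>K\<^esub>"] additive_id _ t]) (simp_all add: pt)
  qed
qed

end

lemma tensor_left_module:
  assumes M: "bimodule R M" and N: "left_module R N"
  shows "left_module R (tensor R M N)"
    and "\<And>a x y. a \<in> carrier R \<Longrightarrow> x \<in> carrier M \<Longrightarrow> y \<in> carrier N \<Longrightarrow>
      a \<odot>\<^bsub>tensor R M N\<^esub> ptensor R M N x y = ptensor R M N (a \<odot>\<^bsub>M\<^esub> x) y"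
proof -
  interpret tensor_pair R M N by (rule tensor_pairI[OF M N])
  note * = left_module_tensor_group[OF bimodule_left_module[OF M] refl refl
    bimodule.smult_rsmult[OF M] tensor_sel(1-3) tensor_smult]
  show "left_module R (tensor R M N)" by (rule *(1))
  show "a \<odot>\<^bsub>tensor R M N\<^esub> ptensor R M N x y = ptensor R M N (a \<odot>\<^bsub>M\<^esub> x) y"
    if "a \<in> carrier R" "x \<in> carrier M" "y \<in> carrier N" for a x y
    using that by (simp add: *(2))
qed

lemma tensor_bimodule_rsmult_ptensor:
  assumes M: "bimodule R M" and N: "bimodule R N" and a: "a \<in> carrier R"
  shows "additive_map (tensor_group R M N) (tensor_group R M N) (\<lambda>t. t \<odot>\<^sub>r\<^bsub>tensor_bimodule R M N\<^esub> a)"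
    and "\<And>x y. x \<in> carrier M \<Longrightarrow> y \<in> carrier N \<Longrightarrow>
      ptensor R M N x y \<odot>\<^sub>r\<^bsub>tensor_bimodule R M N\<^esub> a = ptensor R M N x (y \<odot>\<^sub>r\<^bsub>N\<^esub> a)"
proof -
  interpret tensor_pair R M N by (rule tensor_pairI[OF M bimodule_left_module[OF N]])
  interpret T: abelian_group T by (rule abelian_group_tensor_group)
  interpret N: bimodule R N by (rule N)
  have bal: "balanced R M N T (\<lambda>(x, y). ptensor R M N x (y \<odot>\<^sub>r\<^bsub>N\<^esub> a))"
  proof (rule balancedI; simp only: prod.case)
    fix x assume x: "x \<in> carrier M"
    from additive_comp[OF rsmult_additive[OF N a] ptensor_additive_right[OF x]]
    show "additive_map N T (\<lambda>y. ptensor R M N x (y \<odot>\<^sub>r\<^bsub>N\<^esub> a))" .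
  next
    fix x b y assume "x \<in> carrier M" "b \<in> carrier R" "y \<in> carrier N"
    then show "ptensor R M N (x \<odot>\<^sub>r\<^bsub>M\<^esub> b) (y \<odot>\<^sub>r\<^bsub>N\<^esub> a) = ptensor R M N x ((b \<odot>\<^bsub>N\<^esub> y) \<odot>\<^sub>r\<^bsub>N\<^esub> a)"
      using a by (simp add: ptensor_balanced N.rsmult_closed N.smult_rsmult)
  qed (simp add: ptensor_additive_left a N.rsmult_closed)
  show "additive_map T T (\<lambda>t. t \<odot>\<^sub>r\<^bsub>tensor_bimodule R M N\<^esub> a)"
    unfolding tensor_bimodule_rsmult by (rule tensor_lift_additive[OF T.abelian_group_axioms bal])
  show "ptensor R M N x y \<odot>\<^sub>r\<^bsub>tensor_bimodule R M N\<^esub> a = ptensor R M N x (y \<odot>\<^sub>r\<^bsub>N\<^esub> a)"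
    if "x \<in> carrier M" "y \<in> carrier N" for x y
    unfolding tensor_bimodule_rsmult
    using tensor_lift_ptensor[OF T.abelian_group_axioms bal that] by simp
qed

lemma tensor_pair_tensor_bimodule:
  assumes L: "bimodule R L" and M: "bimodule R M" and N: "left_module R N"
  shows "tensor_pair R (tensor_bimodule R L M) N"
proof -
  interpret LM: tensor_pair R L M by (rule tensor_pairI[OF L bimodule_left_module[OF M]])
  show ?thesis
  proof (intro tensor_pair.intro left_module_abelian_group[OF N] left_module.smult_closed[OF N])
    show "abelian_group (tensor_bimodule R L M)"
      by (rule abelian_group_cong[OF LM.abelian_group_tensor_group]) simp_all
  qed (simp_all add: additive_closed[OF tensor_bimodule_rsmult_ptensor(1)[OF L M]])
qed

lemma bimodule_regular:
  assumes "ring R"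
  shows "bimodule R (regular_bimodule R)"
proof -
  interpret R: ring R by fact
  have "abelian_group (regular_bimodule R)"
    by (rule abelian_group_cong[OF R.abelian_group_axioms]) (simp_all add: regular_bimodule_def)
  then show ?thesis
    by (intro bimodule.intro left_module.intro left_module_axioms.intro bimodule_axioms.intro assms)
      (auto simp: regular_bimodule_def R.l_distr R.r_distr R.m_assoc)
qed

section \<open>Functoriality, associator and left unitor\<close>

lemma tensor_map_balanced:
  assumes "tensor_pair R M N" "tensor_pair R M' N'"
    and f: "f \<in> rmod_hom R M M'" and g: "g \<in> lmod_hom R N N'"
  shows "balanced R M N (tensor R M' N') (\<lambda>(x, y). ptensor R M' N' (f x) (g y))"
proof -
  interpret A: tensor_pair R M N by fact
  interpret B: tensor_pair R M' N' by fact
  have fc: "f x \<in> carrier M'" if "x \<in> carrier M" for x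
    using additive_closed[OF rmod_hom_additive[OF f] that] .
  have gc: "g y \<in> carrier N'" if "y \<in> carrier N" for y
    using lmod_hom_closed[OF g that] .
  show ?thesis
  proof (rule balancedI; simp only: prod.case additive_tensor)
    fix y assume "y \<in> carrier N"
    from additive_comp[OF rmod_hom_additive[OF f] B.ptensor_additive_left[OF gc[OF this]]]
    show "additive_map M B.T (\<lambda>x. ptensor R M' N' (f x) (g y))" .
  next
    fix x assume "x \<in> carrier M"
    from additive_comp[OF lmod_hom_additive[OF g] B.ptensor_additive_right[OF fc[OF this]]]
    show "additive_map N B.T (\<lambda>y. ptensor R M' N' (f x) (g y))" .
  next
    fix x a y assume "x \<in> carrier M" "a \<in> carrier R" "y \<in> carrier N"
    then show "ptensor R M' N' (f (x \<odot>\<^sub>r\<^bsub>M\<^esub> a)) (g y) = ptensor R M' N' (f x) (g (a \<odot>\<^bsub>N\<^esub> y))"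
      using f g by (simp add: rmod_hom_rsmult lmod_hom_smult B.ptensor_balanced fc gc)
  qed
qed

lemma tensor_map_additive:
  assumes "tensor_pair R M N" "tensor_pair R M' N'"
    and f: "f \<in> rmod_hom R M M'" and g: "g \<in> lmod_hom R N N'"
  shows "additive_map (tensor_group R M N) (tensor_group R M' N') (tensor_map R M' N' f g)"
  unfolding tensor_map_def
  using tensor_pair.tensor_lift_additive[OF assms(1) tensor_pair.abelian_group_tensor[OF assms(2)]
      tensor_map_balanced[OF assms]]
  by simp

lemma tensor_map_ptensor:
  assumes "tensor_pair R M N" "tensor_pair R M' N'"
    and f: "f \<in> rmod_hom R M M'" and g: "g \<in> lmod_hom R N N'"
    and "x \<in> carrier M" "y \<in> carrier N"
  shows "tensor_map R M' N' f g (ptensor R M N x y) = ptensor R M' N' (f x) (g y)"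
  unfolding tensor_map_def
  using tensor_pair.tensor_lift_ptensor[OF assms(1) tensor_pair.abelian_group_tensor[OF assms(2)]
      tensor_map_balanced[OF assms(1-4)] assms(5,6)]
  by simp

lemma tensor_map_id_lmod_hom:
  assumes C: "bimodule R C" and N: "left_module R N" and N': "left_module R N'" and g: "g \<in> lmod_hom R N N'"
  shows "tensor_map R C N' id g \<in> lmod_hom R (tensor R C N) (tensor R C N')"
proof -
  interpret A: tensor_pair R C N by (rule tensor_pairI[OF C N])
  interpret B: tensor_pair R C N' by (rule tensor_pairI[OF C N'])
  note pairs = A.tensor_pair_axioms B.tensor_pair_axioms rmod_hom_id g
  note add = tensor_map_additive[OF pairs] and pt = tensor_map_ptensor[OF pairs]
  show ?thesis
  proof (rule lmod_homI)
    show "additive_map (tensor R C N) (tensor R C N') (tensor_map R C N' id g)"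
      using add by simp
    fix a t assume a: "a \<in> carrier R" and "t \<in> carrier (tensor R C N)"
    then have t: "t \<in> carrier A.T" by simp
    have s: "additive_map A.T A.T (\<lambda>t. a \<odot>\<^bsub>tensor R C N\<^esub> t)" "additive_map B.T B.T (\<lambda>t. a \<odot>\<^bsub>tensor R C N'\<^esub> t)"
      using smult_additive[OF tensor_left_module(1)[OF C N] a] smult_additive[OF
          tensor_left_module(1)[OF C N'] a]
      by simp_all
    show "tensor_map R C N' id g (a \<odot>\<^bsub>tensor R C N\<^esub> t) = a \<odot>\<^bsub>tensor R C N'\<^esub> tensor_map R C N' id g t"
      by (rule A.tensor_eqI[OF B.abelian_group_tensor_group additive_comp[OF s(1) add] additive_comp[OF
          add s(2)] _ t])
        (use a in \<open>simp add: pt tensor_left_module(2)[OF C N] tensor_left_module(2)[OF C N']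
          left_module.smult_closed[OF bimodule_left_module[OF C]] lmod_hom_closed[OF g]\<close>)
  qed
qed

lemma tensor_map_id_comp:
  assumes C: "bimodule R C" and N: "left_module R N" and N': "left_module R N'" and N'': "left_module R N''"
    and g: "g \<in> lmod_hom R N N'" and h: "h \<in> lmod_hom R N' N''" and t: "t \<in> carrier (tensor_group R C N)"
  shows "tensor_map R C N'' id h (tensor_map R C N' id g t) = tensor_map R C N'' id (\<lambda>x. h (g x)) t"
proof -
  interpret A: tensor_pair R C N by (rule tensor_pairI[OF C N])
  interpret A': tensor_pair R C N' by (rule tensor_pairI[OF C N'])
  interpret A'': tensor_pair R C N'' by (rule tensor_pairI[OF C N''])
  note 1 = A.tensor_pair_axioms A'.tensor_pair_axioms rmod_hom_id g
  note 2 = A'.tensor_pair_axioms A''.tensor_pair_axioms rmod_hom_id h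
  note 3 = A.tensor_pair_axioms A''.tensor_pair_axioms rmod_hom_id lmod_hom_comp[OF g h]
  show ?thesis
    by (rule A.tensor_eqI[OF A''.abelian_group_tensor_group
        additive_comp[OF tensor_map_additive[OF 1] tensor_map_additive[OF 2]] tensor_map_additive[OF 3] _ t])
      (simp add: tensor_map_ptensor[OF 1] tensor_map_ptensor[OF 2] tensor_map_ptensor[OF 3]
          lmod_hom_closed[OF g])
qed

text \<open>A tensor is a combination of pure tensors with entries in the carriers, so the values of
  the maps elsewhere do not matter. Maps in \<open>comod_hom\<close> are not extensional, and this
  is what allows them to be replaced by maps that agree on the carrier.\<close>

lemma tensor_map_id_cong:
  assumes C: "bimodule R C" and N: "left_module R N" and N': "left_module R N'"
    and g: "g \<in> lmod_hom R N N'" and h: "h \<in> lmod_hom R N N'" and eq: "\<And>x. x \<in> carrier N \<Longrightarrow> g x = h x"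
    and t: "t \<in> carrier (tensor_group R C N)"
  shows "tensor_map R C N' id g t = tensor_map R C N' id h t"
proof -
  interpret A: tensor_pair R C N by (rule tensor_pairI[OF C N])
  interpret B: tensor_pair R C N' by (rule tensor_pairI[OF C N'])
  note 1 = A.tensor_pair_axioms B.tensor_pair_axioms rmod_hom_id g
  note 2 = A.tensor_pair_axioms B.tensor_pair_axioms rmod_hom_id h
  show ?thesis
    by (rule A.tensor_eqI[OF B.abelian_group_tensor_group tensor_map_additive[OF 1]
        tensor_map_additive[OF 2] _ t])
      (simp add: tensor_map_ptensor[OF 1] tensor_map_ptensor[OF 2] eq)
qed

text \<open>The associator is a lift of a lift. For fixed z the inner lift \<open>?i z\<close> is
  additive on L \<otimes> M; additivity in z and balancing of the outer lift are then tested on pure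
  tensors of L \<otimes> M, where both reduce to relations in M \<otimes> N. The second claim allows
  an identity to be tested on pure tensors of L \<otimes> M while z stays fixed.\<close>

lemma tensor_assoc:
  assumes L: "bimodule R L" and M: "bimodule R M" and N: "left_module R N"
  shows "additive_map (tensor_group R (tensor_bimodule R L M) N) (tensor_group R L (tensor R M N))
      (tensor_assoc R L M N)"
    and "\<And>z. z \<in> carrier N \<Longrightarrow> additive_map (tensor_group R L M) (tensor_group R L (tensor R M N))
      (\<lambda>t. tensor_assoc R L M N (ptensor R (tensor_bimodule R L M) N t z))"
    and "\<And>x y z. x \<in> carrier L \<Longrightarrow> y \<in> carrier M \<Longrightarrow> z \<in> carrier N \<Longrightarrow>
      tensor_assoc R L M N (ptensor R (tensor_bimodule R L M) N (ptensor R L M x y) z) =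
        ptensor R L (tensor R M N) x (ptensor R M N y z)"
proof -
  interpret LM: tensor_pair R L M by (rule tensor_pairI[OF L bimodule_left_module[OF M]])
  interpret MN: tensor_pair R M N by (rule tensor_pairI[OF M N])
  interpret LMN: tensor_pair R L "tensor R M N"
    by (rule tensor_pairI[OF L tensor_left_module(1)[OF M N]])
  interpret LM_N: tensor_pair R "tensor_bimodule R L M" N
    by (rule tensor_pair_tensor_bimodule[OF L M N])
  interpret L: bimodule R L by (rule L)
  interpret M: bimodule R M by (rule M)
  interpret N: left_module R N by (rule N)
  interpret T: abelian_group LMN.T by (rule LMN.abelian_group_tensor_group)
  let ?T = "tensor R L (tensor R M N)"
  let ?f = "\<lambda>z (x, y). ptensor R L (tensor R M N) x (ptensor R M N y z)"
  have balf: "balanced R L M ?T (?f z)" if z: "z \<in> carrier N" for z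
  proof (rule balancedI; simp only: prod.case additive_tensor)
    fix y assume "y \<in> carrier M"
    then show "additive_map L LMN.T (\<lambda>x. ptensor R L (tensor R M N) x (ptensor R M N y z))"
      using z by (intro LMN.ptensor_additive_left) (simp add: MN.ptensor_closed)
  next
    fix x assume x: "x \<in> carrier L"
    have "additive_map M (tensor R M N) (\<lambda>y. ptensor R M N y z)"
      using MN.ptensor_additive_left[OF z] by simp
    from additive_comp[OF this LMN.ptensor_additive_right[OF x]]
    show "additive_map M LMN.T (\<lambda>y. ptensor R L (tensor R M N) x (ptensor R M N y z))" .
  next
    fix x a y assume "x \<in> carrier L" "a \<in> carrier R" "y \<in> carrier M"
    then show "ptensor R L (tensor R M N) (x \<odot>\<^sub>r\<^bsub>L\<^esub> a) (ptensor R M N y z) =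
        ptensor R L (tensor R M N) x (ptensor R M N (a \<odot>\<^bsub>M\<^esub> y) z)"
      using z by (simp add: LMN.ptensor_balanced MN.ptensor_closed tensor_left_module(2)[OF M N])
  qed
  let ?i = "\<lambda>z. tensor_lift ?T (?f z)"
  have i_add: "additive_map LM.T LMN.T (?i z)" if "z \<in> carrier N" for z
    using LM.tensor_lift_additive[OF LMN.abelian_group_tensor balf[OF that]] by simp
  have i_pt: "?i z (ptensor R L M x y) = ptensor R L (tensor R M N) x (ptensor R M N y z)"
    if "x \<in> carrier L" "y \<in> carrier M" "z \<in> carrier N" for x y z
    using LM.tensor_lift_ptensor[OF LMN.abelian_group_tensor balf[OF that(3)] that(1,2)] by simp
  have i_add2: "?i (z \<oplus>\<^bsub>N\<^esub> z') t = ?i z t \<oplus>\<^bsub>LMN.T\<^esub> ?i z' t"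
    if "t \<in> carrier LM.T" "z \<in> carrier N" "z' \<in> carrier N" for t z z'
    by (rule LM.tensor_eqI[OF LMN.abelian_group_tensor_group i_add
          additive_plus[OF LMN.abelian_group_tensor_group i_add i_add] _ that(1)])
      (use that MN.ptensor_closed in \<open>auto simp: i_pt MN.ptensor_add_right LMN.ptensor_add_right[simplified]\<close>)
  have bal: "balanced R (tensor_bimodule R L M) N ?T (\<lambda>(t, z). ?i z t)"
  proof (rule balancedI; simp only: prod.case additive_tensor tensor_sel)
    show "additive_map LM.T LMN.T (?i z)" if "z \<in> carrier N" for z
      by (rule i_add[OF that])
    show "additive_map N LMN.T (\<lambda>z. ?i z t)" if "t \<in> carrier LM.T" for t
      by (rule additiveI) (simp_all add: i_add2 that additive_closed[OF i_add])
    fix t a z assume t: "t \<in> carrier LM.T" and a: "a \<in> carrier R" and z: "z \<in> carrier N"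
    show "?i z (t \<odot>\<^sub>r\<^bsub>tensor_bimodule R L M\<^esub> a) = ?i (a \<odot>\<^bsub>N\<^esub> z) t"
      by (rule LM.tensor_eqI[OF LMN.abelian_group_tensor_group
            additive_comp[OF tensor_bimodule_rsmult_ptensor(1)[OF L M a] i_add] i_add _ t])
        (use a z in \<open>auto simp: tensor_bimodule_rsmult_ptensor(2)[OF L M a] i_pt M.rsmult_closed
          N.smult_closed MN.ptensor_balanced\<close>)
  qed
  have eq: "tensor_assoc R L M N = tensor_lift ?T (\<lambda>(t, z). ?i z t)"
    by (simp add: tensor_assoc_def Let_def)
  show "additive_map LM_N.T LMN.T (tensor_assoc R L M N)"
    unfolding eq using LM_N.tensor_lift_additive[OF LMN.abelian_group_tensor bal] by simp
  have a: "tensor_assoc R L M N (ptensor R (tensor_bimodule R L M) N t z) = ?i z t"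
    if "t \<in> carrier LM.T" "z \<in> carrier N" for t z
    unfolding eq using LM_N.tensor_lift_ptensor[OF LMN.abelian_group_tensor bal _ that(2)] that(1) by simp
  show "additive_map LM.T LMN.T (\<lambda>t. tensor_assoc R L M N (ptensor R (tensor_bimodule R L M) N t z))"
    if z: "z \<in> carrier N" for z
    using i_add[OF z] LM.abelian_group_tensor_group[THEN abelian_group.axioms(1), THEN
        abelian_monoid.a_closed]
    by (auto simp: additive_map_def a z)
  show "tensor_assoc R L M N (ptensor R (tensor_bimodule R L M) N (ptensor R L M x y) z) =
        ptensor R L (tensor R M N) x (ptensor R M N y z)"
    if "x \<in> carrier L" "y \<in> carrier M" "z \<in> carrier N" for x y z
    using that by (simp add: a i_pt LM.ptensor_closed)
qed

lemma tensor_lunit: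
  assumes N: "left_module R N"
  shows "additive_map (tensor_group R (regular_bimodule R) N) N (tensor_lunit N)"
    and "\<And>a y. a \<in> carrier R \<Longrightarrow> y \<in> carrier N \<Longrightarrow>
      tensor_lunit N (ptensor R (regular_bimodule R) N a y) = a \<odot>\<^bsub>N\<^esub> y"
proof -
  interpret N: left_module R N by (rule N)
  interpret RN: tensor_pair R "regular_bimodule R" N
    by (rule tensor_pairI[OF bimodule_regular[OF N.R.ring_axioms] N])
  have c: "carrier (regular_bimodule R) = carrier R"
    by (simp add: regular_bimodule_def)
  have bal: "balanced R (regular_bimodule R) N N (\<lambda>(a, y). a \<odot>\<^bsub>N\<^esub> y)"
    by (auto intro!: balancedI additiveI simp: regular_bimodule_def N.smult_closed N.smult_l_distr
        N.smult_r_distr N.smult_assoc)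
  show "additive_map RN.T N (tensor_lunit N)"
    unfolding tensor_lunit_def by (rule RN.tensor_lift_additive[OF RN.right_abelian bal])
  show "tensor_lunit N (ptensor R (regular_bimodule R) N a y) = a \<odot>\<^bsub>N\<^esub> y"
    if "a \<in> carrier R" "y \<in> carrier N" for a y
    unfolding tensor_lunit_def using RN.tensor_lift_ptensor[OF RN.right_abelian bal] that c by simp
qed


section \<open>Constructing comodules from generating families of maps\<close>

text \<open>A coaction takes values in a tensor product formed with the underlying module. Comodule
  records are therefore built in two stages, module part first, and these rules identify the tensor
  products before and after the coaction is filled in.\<close>

lemma tensor_coaction_update [simp]:
  "ptensor R C (N\<lparr>coaction := r\<rparr>) = ptensor R C N"
  "tensor_group R C (N\<lparr>coaction := r\<rparr>) = tensor_group R C N"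
  "tensor R C (N\<lparr>coaction := r\<rparr>) = tensor R C N"
  "tensor_map R C (N\<lparr>coaction := r\<rparr>) = tensor_map R C N"
proof -
  have *: "tensor_rels R C (N\<lparr>coaction := r\<rparr>) = tensor_rels R C N"
    "tensor_free C (N\<lparr>coaction := r\<rparr>) = tensor_free C N"
    by (simp_all add: tensor_rels_def tensor_free_def)
  then show p: "ptensor R C (N\<lparr>coaction := r\<rparr>) = ptensor R C N"
    by (intro ext) (simp add: ptensor_def)
  from * show g: "tensor_group R C (N\<lparr>coaction := r\<rparr>) = tensor_group R C N"
    by (simp add: tensor_group_def)
  from p g show t: "tensor R C (N\<lparr>coaction := r\<rparr>) = tensor R C N"
    by (simp add: tensor_def)
  from p t show "tensor_map R C (N\<lparr>coaction := r\<rparr>) = tensor_map R C N"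
    by (intro ext) (simp add: tensor_map_def)
qed

lemma lmod_hom_coaction_update [simp]:
  "lmod_hom R (N\<lparr>coaction := r\<rparr>) M = lmod_hom R N M"
  "lmod_hom R M (N\<lparr>coaction := r\<rparr>) = lmod_hom R M N"
  by (simp_all add: lmod_hom_def)

lemma coring_bimodule: "coring R C \<Longrightarrow> bimodule R C"
  by (simp add: coring_def)

lemma left_comodule_left_module: "left_comodule R C M \<Longrightarrow> left_module R M"
  by (simp add: left_comodule_def)

lemma left_comodule_coring: "left_comodule R C M \<Longrightarrow> coring R C"
  by (simp add: left_comodule_def)

lemmas left_comodule_bimodule = coring_bimodule[OF left_comodule_coring]
lemmas left_comodule_abelian_group = left_module_abelian_group[OF left_comodule_left_module]

section \<open>The comonad C \<otimes> - and its naturality\<close>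

text \<open>On a pure tensor c \<otimes> y both sides are the scalar \<epsilon>(c) applied to u y,
  by linearity of u. This is naturality of the counit of the comonad C \<otimes> - on left
  modules.\<close>

lemma counit_natural:
  assumes C: "coring R C" and N: "left_module R N" and N': "left_module R N'"
    and u: "u \<in> lmod_hom R N N'" and t: "t \<in> carrier (tensor_group R C N)"
  shows "tensor_lunit N' (tensor_map R (regular_bimodule R) N' (counit C) id (tensor_map R C N' id u t)) =
    u (tensor_lunit N (tensor_map R (regular_bimodule R) N (counit C) id t))"
proof -
  interpret N: left_module R N by (rule N)
  note B = coring_bimodule[OF C] and Reg = bimodule_regular[OF N.R.ring_axioms]
  interpret CN: tensor_pair R C N by (rule tensor_pairI[OF B N])
  note e = bimod_hom_rmod_hom[OF coring.counit_hom[OF C]]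
  have ec: "counit C c \<in> carrier R" if "c \<in> carrier C" for c
    using additive_closed[OF rmod_hom_additive[OF e] that] by (simp add: regular_bimodule_def)
  note 1 = tensor_pairI[OF B N'] tensor_pairI[OF Reg N'] e lmod_hom_id(2)
  note 2 = tensor_pairI[OF B N] tensor_pairI[OF Reg N] e lmod_hom_id(2)
  note 3 = tensor_pairI[OF B N] tensor_pairI[OF B N'] rmod_hom_id u
  show ?thesis
    by (rule CN.tensor_eqI[OF left_module_abelian_group[OF N']
          additive_comp[OF additive_comp[OF tensor_map_additive[OF 3] tensor_map_additive[OF 1]]
              tensor_lunit(1)[OF N']]
          additive_comp[OF additive_comp[OF tensor_map_additive[OF 2] tensor_lunit(1)[OF N]]
              lmod_hom_additive[OF u]] _ t])
      (simp add: tensor_map_ptensor[OF 1] tensor_map_ptensor[OF 2] tensor_map_ptensor[OF 3]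
        lmod_hom_closed[OF u] tensor_lunit(2)[OF N] tensor_lunit(2)[OF N'] ec lmod_hom_smult[OF u])
qed

text \<open>Naturality of the comultiplication of the comonad C \<otimes> -: one side acts on the
  factors in C and the other on the module factor.\<close>

lemma comult_natural:
  assumes C: "coring R C" and N: "left_module R N" and N': "left_module R N'"
    and u: "u \<in> lmod_hom R N N'" and t: "t \<in> carrier (tensor_group R C N)"
  shows "tensor_assoc R C C N' (tensor_map R (tensor_bimodule R C C) N' (comult C) id (tensor_map R C N'
      id u t)) =
    tensor_map R C (tensor R C N') id (tensor_map R C N' id u)
      (tensor_assoc R C C N (tensor_map R (tensor_bimodule R C C) N (comult C) id t))"
proof -
  note B = coring_bimodule[OF C]
  interpret CN: tensor_pair R C N by (rule tensor_pairI[OF B N])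
  interpret CN': tensor_pair R C N' by (rule tensor_pairI[OF B N'])
  interpret CC: tensor_pair R C C by (rule tensor_pairI[OF B bimodule_left_module[OF B]])
  note L = tensor_left_module(1)[OF B N] and L' = tensor_left_module(1)[OF B N']
  interpret CCN': tensor_pair R C "tensor R C N'" by (rule tensor_pairI[OF B L'])
  note d = bimod_hom_rmod_hom[OF coring.comult_hom[OF C]]
  have dc: "comult C c \<in> carrier CC.T" if "c \<in> carrier C" for c
    using additive_closed[OF rmod_hom_additive[OF d] that] by simp
  note iu = tensor_map_id_lmod_hom[OF B N N' u]
  note P = tensor_pair_tensor_bimodule[OF B B N] and P' = tensor_pair_tensor_bimodule[OF B B N']
  note 1 = tensor_pairI[OF B N'] P' d lmod_hom_id(2)
  note 2 = tensor_pairI[OF B N] P d lmod_hom_id(2)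
  note 3 = tensor_pairI[OF B N] tensor_pairI[OF B N'] rmod_hom_id u
  note 4 = tensor_pairI[OF B L] tensor_pairI[OF B L'] rmod_hom_id iu
  note add = CCN'.abelian_group_tensor_group
  \<comment> \<open>Reduction to pure tensors happens twice: \<open>comult C c\<close> is an
    arbitrary element \<open>s\<close> of C \<otimes> C, so after c \<otimes> y has been reached,
    \<open>s\<close> in turn is replaced by pure tensors.\<close>
  have inner: "tensor_assoc R C C N' (ptensor R (tensor_bimodule R C C) N' s (u y)) =
    tensor_map R C (tensor R C N') id (tensor_map R C N' id u)
      (tensor_assoc R C C N (ptensor R (tensor_bimodule R C C) N s y))"
    if s: "s \<in> carrier CC.T" and y: "y \<in> carrier N" for s y
    by (rule CC.tensor_eqI[OF add tensor_assoc(2)[OF B B N' lmod_hom_closed[OF u y]]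
          additive_comp[OF tensor_assoc(2)[OF B B N y] tensor_map_additive[OF 4]] _ s])
      (simp add: tensor_assoc(3)[OF B B N] tensor_assoc(3)[OF B B N'] y lmod_hom_closed[OF u]
        tensor_map_ptensor[OF 4] tensor_map_ptensor[OF 3] CN.ptensor_closed)
  show ?thesis
    by (rule CN.tensor_eqI[OF add
          additive_comp[OF additive_comp[OF tensor_map_additive[OF 3] tensor_map_additive[OF 1]]
              tensor_assoc(1)[OF B B N']]
          additive_comp[OF additive_comp[OF tensor_map_additive[OF 2] tensor_assoc(1)[OF B B N]]
              tensor_map_additive[OF 4]] _ t])
      (simp add: tensor_map_ptensor[OF 1] tensor_map_ptensor[OF 2] tensor_map_ptensor[OF 3]
        lmod_hom_closed[OF u] inner dc)
qed

section \<open>Comodule homomorphisms\<close>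

lemma comod_hom_lmod_hom: "f \<in> comod_hom R C M N \<Longrightarrow> f \<in> lmod_hom R M N"
  by (simp add: comod_hom_def)

lemma comod_hom_coaction:
  "f \<in> comod_hom R C M N \<Longrightarrow> x \<in> carrier M \<Longrightarrow> coaction N (f x) = tensor_map R C N id f (coaction M x)"
  by (simp add: comod_hom_def)

lemma comod_hom_closed: "f \<in> comod_hom R C M N \<Longrightarrow> x \<in> carrier M \<Longrightarrow> f x \<in> carrier N"
  by (rule lmod_hom_closed[OF comod_hom_lmod_hom])

lemma comod_homI:
  "f \<in> lmod_hom R M N \<Longrightarrow> (\<And>x. x \<in> carrier M \<Longrightarrow> coaction N (f x) = tensor_map R C N id f (coaction M x))
    \<Longrightarrow> f \<in> comod_hom R C M N"
  by (simp add: comod_hom_def)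

lemma coaction_additive: "left_comodule R C M \<Longrightarrow> additive_map M (tensor_group R C M) (coaction M)"
  using lmod_hom_additive[OF left_comodule.coaction_hom] by fastforce

lemmas coaction_closed = additive_closed[OF coaction_additive]

lemma comod_hom_comp:
  assumes M: "left_comodule R C M" and N: "left_comodule R C N" and L: "left_comodule R C L"
    and f: "f \<in> comod_hom R C M N" and g: "g \<in> comod_hom R C N L"
  shows "(\<lambda>x. g (f x)) \<in> comod_hom R C M L"
  using tensor_map_id_comp[OF left_comodule_bimodule[OF M] M[THEN left_comodule_left_module]
      N[THEN left_comodule_left_module] L[THEN left_comodule_left_module]
      f[THEN comod_hom_lmod_hom] g[THEN comod_hom_lmod_hom] coaction_closed[OF M]]
  by (intro comod_homI lmod_hom_comp[OF f[THEN comod_hom_lmod_hom] g[THEN comod_hom_lmod_hom]])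
    (simp add: comod_hom_coaction[OF f] comod_hom_coaction[OF g] comod_hom_closed[OF f])

lemma comod_hom_cong:
  assumes M: "left_comodule R C M" and N: "left_comodule R C N"
    and f: "f \<in> comod_hom R C M N" and eq: "\<And>x. x \<in> carrier M \<Longrightarrow> g x = f x"
  shows "g \<in> comod_hom R C M N"
proof -
  interpret M: left_module R M by (rule left_comodule_left_module[OF M])
  have g: "g \<in> lmod_hom R M N"
    using comod_hom_lmod_hom[OF f] by (auto simp: lmod_hom_def eq Pi_iff M.smult_closed)
  show ?thesis
    using tensor_map_id_cong[OF left_comodule_bimodule[OF M] M[THEN left_comodule_left_module]
        N[THEN left_comodule_left_module] g f[THEN comod_hom_lmod_hom] eq coaction_closed[OF M]]
    by (intro comod_homI g) (simp add: comod_hom_coaction[OF f] eq)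
qed

lemma comod_hom_id:
  assumes M: "left_comodule R C M"
  shows "(\<lambda>x. x) \<in> comod_hom R C M M"
proof -
  note B = left_comodule_bimodule[OF M] and L = left_comodule_left_module[OF M]
  interpret CM: tensor_pair R C M by (rule tensor_pairI[OF B L])
  note 1 = CM.tensor_pair_axioms CM.tensor_pair_axioms rmod_hom_id lmod_hom_id(1)
  have "tensor_map R C M id (\<lambda>x. x) t = t" if "t \<in> carrier CM.T" for t
    by (rule CM.tensor_eqI[OF CM.abelian_group_tensor_group tensor_map_additive[OF 1] additive_id _ that])
      (simp add: tensor_map_ptensor[OF 1])
  then show ?thesis
    by (intro comod_homI lmod_hom_id) (simp add: coaction_closed[OF M])
qed

lemma tensor_map_id_plus:
  assumes C: "bimodule R C" and N: "left_module R N" and N': "left_module R N'"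
    and g: "g \<in> lmod_hom R N N'" and h: "h \<in> lmod_hom R N N'" and k: "k \<in> lmod_hom R N N'"
    and eq: "\<And>x. x \<in> carrier N \<Longrightarrow> k x = g x \<oplus>\<^bsub>N'\<^esub> h x" and t: "t \<in> carrier (tensor_group R C N)"
  shows "tensor_map R C N' id k t =
    tensor_map R C N' id g t \<oplus>\<^bsub>tensor_group R C N'\<^esub> tensor_map R C N' id h t"
proof -
  interpret A: tensor_pair R C N by (rule tensor_pairI[OF C N])
  interpret B: tensor_pair R C N' by (rule tensor_pairI[OF C N'])
  note pairs = A.tensor_pair_axioms B.tensor_pair_axioms rmod_hom_id
  show ?thesis
    by (rule A.tensor_eqI[OF B.abelian_group_tensor_group tensor_map_additive[OF pairs k]
          additive_plus[OF B.abelian_group_tensor_group tensor_map_additive[OF pairs g]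
              tensor_map_additive[OF pairs h]] _ t])
      (simp add: tensor_map_ptensor[OF pairs k] tensor_map_ptensor[OF pairs g] tensor_map_ptensor[OF pairs h]
        eq B.ptensor_add_right lmod_hom_closed[OF g] lmod_hom_closed[OF h])
qed

lemma zero_comod_hom:
  assumes M: "left_comodule R C M" and N: "left_comodule R C N"
  shows "(\<lambda>x. \<zero>\<^bsub>N\<^esub>) \<in> comod_hom R C M N"
proof -
  note B = left_comodule_bimodule[OF M] and L = left_comodule_left_module[OF M] and L' =
      left_comodule_left_module[OF N]
  interpret N: left_module R N by (rule L')
  interpret CM: tensor_pair R C M by (rule tensor_pairI[OF B L])
  interpret CN: tensor_pair R C N by (rule tensor_pairI[OF B L'])
  interpret T: abelian_group CN.T by (rule CN.abelian_group_tensor_group)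
  have "a \<odot>\<^bsub>N\<^esub> \<zero>\<^bsub>N\<^esub> = \<zero>\<^bsub>N\<^esub>" if "a \<in> carrier R" for a
    using additive_zero[OF N.M.abelian_group_axioms N.M.abelian_group_axioms smult_additive[OF L' that]] .
  then have z: "(\<lambda>x. \<zero>\<^bsub>N\<^esub>) \<in> lmod_hom R M N"
    by (auto simp: lmod_hom_def)
  note 1 = CM.tensor_pair_axioms CN.tensor_pair_axioms rmod_hom_id z
  have z': "additive_map CM.T CN.T (\<lambda>t. \<zero>\<^bsub>CN.T\<^esub>)"
    by (rule additiveI) auto
  have "tensor_map R C N id (\<lambda>x. \<zero>\<^bsub>N\<^esub>) t = \<zero>\<^bsub>CN.T\<^esub>" if "t \<in> carrier CM.T" for t
    by (rule CM.tensor_eqI[OF CN.abelian_group_tensor_group tensor_map_additive[OF 1] z' _ that])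
      (simp add: tensor_map_ptensor[OF 1] additive_zero[OF N.M.abelian_group_axioms
          T.abelian_group_axioms CN.ptensor_additive_right])
  moreover have "coaction N \<zero>\<^bsub>N\<^esub> = \<zero>\<^bsub>CN.T\<^esub>"
    by (rule additive_zero[OF N.M.abelian_group_axioms T.abelian_group_axioms coaction_additive[OF N]])
  ultimately show ?thesis
    by (intro comod_homI z) (simp add: coaction_closed[OF M])
qed

section \<open>Comodules generated by images of maps\<close>

text \<open>Both sides of each axiom are additive in x, so x = u a suffices. There the comonad
  structure is natural along u, and the axiom for P at u a becomes the image under u of the axiom
  for A at a.\<close>

lemma left_comodule_generated:
  assumes A: "left_comodule R C A" and P: "left_module R P"
    and r: "coaction P \<in> lmod_hom R P (tensor R C P)"
    and I: "\<And>u. u \<in> I \<Longrightarrow> u \<in> comod_hom R C A P"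
    and gen: "generates P {u a | u a. u \<in> I \<and> a \<in> carrier A}"
  shows "left_comodule R C P"
proof -
  note C = left_comodule_coring[OF A] and B = left_comodule_bimodule[OF A] and LA =
      left_comodule_left_module[OF A]
  note G = left_module_abelian_group[OF P]
  interpret P: left_module R P by (rule P)
  note Reg = bimodule_regular[OF P.R.ring_axioms]
  note e = bimod_hom_rmod_hom[OF coring.counit_hom[OF C]]
  note d = bimod_hom_rmod_hom[OF coring.comult_hom[OF C]]
  note TP = tensor_left_module(1)[OF B P]
  note ra = lmod_hom_additive[OF r, simplified]
  note 1 = tensor_pairI[OF B P] tensor_pairI[OF Reg P] e lmod_hom_id(2)
  note 2 = tensor_pairI[OF B P] tensor_pair_tensor_bimodule[OF B B P] d lmod_hom_id(2)
  note 3 = tensor_pairI[OF B P] tensor_pairI[OF B TP] rmod_hom_id r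
  have coassoc: "tensor_assoc R C C P (tensor_map R (tensor_bimodule R C C) P (comult C) id (coaction P x))
      = tensor_map R C (tensor R C P) id (coaction P) (coaction P x)" if x: "x \<in> carrier P" for x
  proof (rule additive_eqI[OF gen G tensor_pair.abelian_group_tensor_group[OF tensor_pairI[OF B TP]]
      additive_comp[OF additive_comp[OF ra tensor_map_additive[OF 2]] tensor_assoc(1)[OF B B P]]
      additive_comp[OF ra tensor_map_additive[OF 3]] _ x])
    fix x assume "x \<in> {u a | u a. u \<in> I \<and> a \<in> carrier A}"
    then obtain u a where u: "u \<in> comod_hom R C A P" and a: "a \<in> carrier A" and x: "x = u a"
      using I by blast
    note ul = comod_hom_lmod_hom[OF u]
    note ca = coaction_closed[OF A a]
    have cA: "coaction A \<in> lmod_hom R A (tensor R C A)" by (rule left_comodule.coaction_hom[OF A])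
    note iu = tensor_map_id_lmod_hom[OF B LA P ul]
    \<comment> \<open>Naturality pulls the left side back to A, where coassociativity holds;
      functoriality and the compatibility of \<open>u\<close> with the coactions then carry the
      result forward to P.\<close>
    have "tensor_assoc R C C P (tensor_map R (tensor_bimodule R C C) P (comult C) id (coaction P x)) =
      tensor_map R C (tensor R C P) id (tensor_map R C P id u)
        (tensor_map R C (tensor R C A) id (coaction A) (coaction A a))"
      by (simp add: x comod_hom_coaction[OF u a] comult_natural[OF C LA P ul ca]
          left_comodule.coaction_coassoc[OF A a])
    also have "\<dots> = tensor_map R C (tensor R C P) id (\<lambda>x. tensor_map R C P id u (coaction A x)) (coaction A a)"
      by (rule tensor_map_id_comp[OF B LA tensor_left_module(1)[OF B LA] TP cA iu ca])
    also have "\<dots> = tensor_map R C (tensor R C P) id (\<lambda>x. coaction P (u x)) (coaction A a)"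
      by (rule tensor_map_id_cong[OF B LA TP lmod_hom_comp[OF cA iu] lmod_hom_comp[OF ul r] _ ca])
        (simp add: comod_hom_coaction[OF u])
    also have "\<dots> = tensor_map R C (tensor R C P) id (coaction P) (coaction P x)"
      by (simp add: x comod_hom_coaction[OF u a] tensor_map_id_comp[OF B LA P TP ul r ca])
    finally show "tensor_assoc R C C P (tensor_map R (tensor_bimodule R C C) P (comult C) id (coaction P x))
      = tensor_map R C (tensor R C P) id (coaction P) (coaction P x)" .
  qed
  have counit: "tensor_lunit P (tensor_map R (regular_bimodule R) P (counit C) id (coaction P x)) = x"
    if x: "x \<in> carrier P" for x
  proof (rule additive_eqI[OF gen G G
      additive_comp[OF additive_comp[OF ra tensor_map_additive[OF 1]] tensor_lunit(1)[OF P]] additive_id _ x])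
    fix x assume "x \<in> {u a | u a. u \<in> I \<and> a \<in> carrier A}"
    then obtain u a where u: "u \<in> comod_hom R C A P" and a: "a \<in> carrier A" and x: "x = u a"
      using I by blast
    show "tensor_lunit P (tensor_map R (regular_bimodule R) P (counit C) id (coaction P x)) = x"
      by (simp add: x comod_hom_coaction[OF u a]
          counit_natural[OF C LA P comod_hom_lmod_hom[OF u] coaction_closed[OF A a]]
          left_comodule.coaction_counit[OF A a])
  qed
  show ?thesis
    by (intro left_comodule.intro left_comodule_axioms.intro C P r coassoc counit)
qed

text \<open>Compatibility with the coactions is an identity of additive maps. On an element u a it
  follows from the colinearity of u and of the composite of h with u.\<close>

lemma comod_hom_generated:
  assumes A: "left_comodule R C A" and P: "left_comodule R C P" and Q: "left_comodule R C Q"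
    and I: "\<And>u. u \<in> I \<Longrightarrow> u \<in> comod_hom R C A P"
    and gen: "generates P {u a | u a. u \<in> I \<and> a \<in> carrier A}"
    and h: "h \<in> lmod_hom R P Q"
    and hu: "\<And>u. u \<in> I \<Longrightarrow> (\<lambda>a. h (u a)) \<in> comod_hom R C A Q"
  shows "h \<in> comod_hom R C P Q"
proof (rule comod_homI[OF h])
  note B = left_comodule_bimodule[OF A] and LA = left_comodule_left_module[OF A]
    and LP = left_comodule_left_module[OF P] and LQ = left_comodule_left_module[OF Q]
  note 1 = tensor_pairI[OF B LP] tensor_pairI[OF B LQ] rmod_hom_id h
  fix x assume x: "x \<in> carrier P"
  show "coaction Q (h x) = tensor_map R C Q id h (coaction P x)"
  proof (rule additive_eqI[OF gen left_comodule_abelian_group[OF P]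
        tensor_pair.abelian_group_tensor_group[OF tensor_pairI[OF B LQ]]
        additive_comp[OF lmod_hom_additive[OF h] coaction_additive[OF Q]]
        additive_comp[OF coaction_additive[OF P] tensor_map_additive[OF 1]] _ x])
    fix x assume "x \<in> {u a | u a. u \<in> I \<and> a \<in> carrier A}"
    then obtain u a where u: "u \<in> I" and a: "a \<in> carrier A" and x: "x = u a"
      by blast
    show "coaction Q (h x) = tensor_map R C Q id h (coaction P x)"
      using tensor_map_id_comp[OF B LA LP LQ comod_hom_lmod_hom[OF I[OF u]] h coaction_closed[OF A a]]
      by (simp add: x comod_hom_coaction[OF hu[OF u] a] comod_hom_coaction[OF I[OF u] a])
  qed
qed

section \<open>Isomorphic copies on another type\<close>

lemma left_module_transport:
  fixes Q :: "('r, 'u, 'z) module_scheme"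
  assumes P: "left_module R P" and e: "inj_on e (carrier P)"
    and Q: "carrier Q = e ` carrier P"
      "\<And>x y. x \<in> carrier P \<Longrightarrow> y \<in> carrier P \<Longrightarrow> e x \<oplus>\<^bsub>Q\<^esub> e y = e (x \<oplus>\<^bsub>P\<^esub> y)"
      "\<zero>\<^bsub>Q\<^esub> = e \<zero>\<^bsub>P\<^esub>"
      "\<And>a x. a \<in> carrier R \<Longrightarrow> x \<in> carrier P \<Longrightarrow> a \<odot>\<^bsub>Q\<^esub> e x = e (a \<odot>\<^bsub>P\<^esub> x)"
  shows "left_module R Q"
proof -
  interpret P: left_module R P by (rule P)
  have "abelian_group Q"
  proof (rule abelian_groupI)
    fix x assume "x \<in> carrier Q"
    then obtain x' where "x' \<in> carrier P" "x = e x'" by (auto simp: Q)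
    then show "\<exists>y\<in>carrier Q. y \<oplus>\<^bsub>Q\<^esub> x = \<zero>\<^bsub>Q\<^esub>"
      by (auto simp: Q P.M.l_neg intro!: bexI[of _ "\<ominus>\<^bsub>P\<^esub> x'"])
  qed (auto simp: Q P.M.a_ac)
  then show ?thesis
    by (intro left_module.intro left_module_axioms.intro P.R.ring_axioms)
      (auto simp: Q P.smult_closed P.smult_l_distr P.smult_r_distr P.smult_assoc P.smult_one)
qed

lemma left_comodule_transport:
  fixes P :: "('r, 'p, 'c, 'z) comodule_scheme" and e :: "'p \<Rightarrow> 'u"
  assumes P: "left_comodule R C P" and e: "inj_on e (carrier P)"
  obtains Q :: "('r, 'u, 'c) comodule"
  where "left_comodule R C Q" "carrier Q = e ` carrier P" "e \<in> comod_hom R C P Q"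
    "inv_into (carrier P) e \<in> comod_hom R C Q P"
proof -
  note B = left_comodule_bimodule[OF P] and LP = left_comodule_left_module[OF P]
  interpret P: left_module R P by (rule LP)
  define e' where "e' = inv_into (carrier P) e"
  have e' [simp]: "e' (e x) = x" if "x \<in> carrier P" for x
    using e that by (simp add: e'_def)
  define Q0 :: "('r, 'u, 'c) comodule" where "Q0 =
    \<lparr>carrier = e ` carrier P, monoid.mult = undefined, monoid.one = undefined,
      ring.zero = e \<zero>\<^bsub>P\<^esub>, ring.add = (\<lambda>x y. e (e' x \<oplus>\<^bsub>P\<^esub> e' y)),
      smult = (\<lambda>a x. e (a \<odot>\<^bsub>P\<^esub> e' x)), coaction = undefined\<rparr>"
  \<comment> \<open>The coaction is carried over by C \<otimes> e, whose target is formed with the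
    module part \<open>Q0\<close>.\<close>
  define Q where "Q = Q0\<lparr>coaction := (\<lambda>x. tensor_map R C Q0 id e (coaction P (e' x)))\<rparr>"
  have Q: "left_module R Q"
    by (rule left_module_transport[OF LP e]) (simp_all add: Q_def Q0_def)
  have carrier: "carrier Q = e ` carrier P"
    by (simp add: Q_def Q0_def)
  have el: "e \<in> lmod_hom R P Q"
    by (auto simp: lmod_hom_def Q_def Q0_def)
  have e'l: "e' \<in> lmod_hom R Q P"
    by (auto simp: lmod_hom_def Q_def Q0_def P.smult_closed)
  have co: "coaction Q = (\<lambda>x. tensor_map R C Q id e (coaction P (e' x)))"
    by (simp add: Q_def)
  have "coaction Q \<in> lmod_hom R Q (tensor R C Q)"
    unfolding co by (rule lmod_hom_comp[OF lmod_hom_comp[OF e'l left_comodule.coaction_hom[OF P]]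
          tensor_map_id_lmod_hom[OF B LP Q el]])
  moreover have ec: "e \<in> comod_hom R C P Q"
    by (rule comod_homI[OF el]) (simp add: co)
  \<comment> \<open>The single map \<open>e\<close> is already surjective onto Q, so the comodule
    axioms of the copy are an instance of generation by one map from P.\<close>
  moreover have gen: "generates Q {u a | u a. u \<in> {e} \<and> a \<in> carrier P}"
    by (auto simp: generates_def carrier)
  ultimately have QC: "left_comodule R C Q"
    using left_comodule_generated[OF P Q, of "{e}"] by blast
  \<comment> \<open>Colinearity of the inverse is tested along \<open>e\<close>, where the composite
    is the identity of P.\<close>
  have "e' \<in> comod_hom R C Q P"
    by (rule comod_hom_generated[OF P QC P _ gen e'l])
      (use ec in \<open>auto intro!: comod_hom_cong[OF P P comod_hom_id[OF P]]\<close>)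
  with QC carrier ec show ?thesis
    using that unfolding e'_def by blast
qed

section \<open>The biproduct of a comodule with itself\<close>

definition biproduct_module :: "('r, 'm, 's) module_scheme \<Rightarrow> ('r, 'm \<times> 'm, 'c) comodule"
  where "biproduct_module A =
    \<lparr>carrier = carrier A \<times> carrier A, monoid.mult = undefined, monoid.one = undefined,
      ring.zero = (\<zero>\<^bsub>A\<^esub>, \<zero>\<^bsub>A\<^esub>), ring.add = (\<lambda>(x, y) (x', y'). (x \<oplus>\<^bsub>A\<^esub> x', y \<oplus>\<^bsub>A\<^esub> y')),
      smult = (\<lambda>a (x, y). (a \<odot>\<^bsub>A\<^esub> x, a \<odot>\<^bsub>A\<^esub> y)), coaction = undefined\<rparr>"

text \<open>The formula is forced: (x, y) is the sum of the images of x and y under the two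
  injections, and these are to be colinear.\<close>

definition comod_biproduct ::
  "('r, 'o) ring_scheme \<Rightarrow> ('r, 'c, 'q) coring_scheme \<Rightarrow> ('r, 'm, 'c, 's) comodule_scheme \<Rightarrow>
    ('r, 'm \<times> 'm, 'c) comodule"
  where "comod_biproduct R C A = (biproduct_module A)\<lparr>coaction := (\<lambda>(x, y).
    tensor_map R C (biproduct_module A :: ('r, 'm \<times> 'm, 'c) comodule) id (\<lambda>x. (x, \<zero>\<^bsub>A\<^esub>)) (coaction A x)
      \<oplus>\<^bsub>tensor_group R C (biproduct_module A :: ('r, 'm \<times> 'm, 'c) comodule)\<^esub>
    tensor_map R C (biproduct_module A :: ('r, 'm \<times> 'm, 'c) comodule) id (\<lambda>y. (\<zero>\<^bsub>A\<^esub>, y)) (coaction A y))\<rparr>"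

lemma comod_biproduct_sel:
  "carrier (comod_biproduct R C A) = carrier A \<times> carrier A"
  "(x, y) \<oplus>\<^bsub>comod_biproduct R C A\<^esub> (x', y') = (x \<oplus>\<^bsub>A\<^esub> x', y \<oplus>\<^bsub>A\<^esub> y')"
  "\<zero>\<^bsub>comod_biproduct R C A\<^esub> = (\<zero>\<^bsub>A\<^esub>, \<zero>\<^bsub>A\<^esub>)"
  "a \<odot>\<^bsub>comod_biproduct R C A\<^esub> (x, y) = (a \<odot>\<^bsub>A\<^esub> x, a \<odot>\<^bsub>A\<^esub> y)"
  "coaction (comod_biproduct R C A) = (\<lambda>(x, y).
    tensor_map R C (comod_biproduct R C A) id (\<lambda>x. (x, \<zero>\<^bsub>A\<^esub>)) (coaction A x)
      \<oplus>\<^bsub>tensor_group R C (comod_biproduct R C A)\<^esub>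
    tensor_map R C (comod_biproduct R C A) id (\<lambda>y. (\<zero>\<^bsub>A\<^esub>, y)) (coaction A y))"
  by (simp_all add: comod_biproduct_def) (simp_all add: biproduct_module_def)

lemma left_module_smult_zero:
  "left_module R M \<Longrightarrow> a \<in> carrier R \<Longrightarrow> a \<odot>\<^bsub>M\<^esub> \<zero>\<^bsub>M\<^esub> = \<zero>\<^bsub>M\<^esub>"
  by (rule additive_zero[OF _ _ smult_additive]) (simp_all add: left_module_abelian_group)

text \<open>The two injections generate the sum, since (a, b) = (a, 0) + (0, b); the comodule axioms
  and the colinearity of induced maps are therefore checked on the injections. The last three claims
  provide the coproduct structure used for the Eckmann-Hilton argument.\<close>

lemma comod_biproduct:
  assumes A: "left_comodule R C A"
  shows "left_comodule R C (comod_biproduct R C A)"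
    and "(\<lambda>x. (x, \<zero>\<^bsub>A\<^esub>)) \<in> comod_hom R C A (comod_biproduct R C A)"
    and "(\<lambda>x. (\<zero>\<^bsub>A\<^esub>, x)) \<in> comod_hom R C A (comod_biproduct R C A)"
    and "\<And>N f g. left_comodule R C N \<Longrightarrow> f \<in> comod_hom R C A N \<Longrightarrow> g \<in> comod_hom R C A N \<Longrightarrow>
      (\<lambda>(x, y). f x \<oplus>\<^bsub>N\<^esub> g y) \<in> comod_hom R C (comod_biproduct R C A) N"
proof -
  let ?D = "comod_biproduct R C A"
  note B = left_comodule_bimodule[OF A] and LA = left_comodule_left_module[OF A]
  note sel = comod_biproduct_sel
  interpret A: left_module R A by (rule LA)
  have LD: "left_module R ?D"
  proof -
    have "abelian_group ?D"
    proof (rule abelian_groupI)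
      fix x assume "x \<in> carrier ?D"
      then obtain a b where "a \<in> carrier A" "b \<in> carrier A" "x = (a, b)" by (auto simp: sel)
      then show "\<exists>y\<in>carrier ?D. y \<oplus>\<^bsub>?D\<^esub> x = \<zero>\<^bsub>?D\<^esub>"
        by (intro bexI[of _ "(\<ominus>\<^bsub>A\<^esub> a, \<ominus>\<^bsub>A\<^esub> b)"]) (auto simp: sel A.M.l_neg)
    qed (auto simp: sel A.M.a_assoc intro: A.M.a_comm)
    then show ?thesis
      by (intro left_module.intro left_module_axioms.intro A.R.ring_axioms)
        (auto simp: sel A.smult_closed A.smult_l_distr A.smult_r_distr A.smult_assoc A.smult_one)
  qed
  interpret CD: tensor_pair R C ?D by (rule tensor_pairI[OF B LD])
  interpret T: abelian_group CD.T by (rule CD.abelian_group_tensor_group)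
  let ?i = "\<lambda>x. (x, \<zero>\<^bsub>A\<^esub>)" and ?j = "\<lambda>x. (\<zero>\<^bsub>A\<^esub>, x)"
  note z = left_module_smult_zero[OF LA]
  have i: "?i \<in> lmod_hom R A ?D" and j: "?j \<in> lmod_hom R A ?D"
    by (auto simp: lmod_hom_def sel z)
  have p: "fst \<in> lmod_hom R ?D A" and q: "snd \<in> lmod_hom R ?D A"
    by (auto simp: lmod_hom_def sel)
  note cA = left_comodule.coaction_hom[OF A]
  have ci: "(\<lambda>x. tensor_map R C ?D id ?i (coaction A x)) \<in> lmod_hom R A (tensor R C ?D)"
    and cj: "(\<lambda>x. tensor_map R C ?D id ?j (coaction A x)) \<in> lmod_hom R A (tensor R C ?D)"
    using lmod_hom_comp[OF cA tensor_map_id_lmod_hom[OF B LA LD i]]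
      lmod_hom_comp[OF cA tensor_map_id_lmod_hom[OF B LA LD j]] .
  have cpq: "coaction ?D = (\<lambda>x. tensor_map R C ?D id ?i (coaction A (fst x)) \<oplus>\<^bsub>CD.T\<^esub> tensor_map R C ?D
      id ?j (coaction A (snd x)))"
    by (subst sel(5)) (simp add: split_def)
  note cip = lmod_hom_comp[OF p ci] and cjq = lmod_hom_comp[OF q cj]
  interpret TD: left_module R "tensor R C ?D" by (rule tensor_left_module(1)[OF B LD])
  have cD: "coaction ?D \<in> lmod_hom R ?D (tensor R C ?D)"
    unfolding cpq
  proof (rule lmod_homI)
    show "additive_map ?D (tensor R C ?D) (\<lambda>x. tensor_map R C ?D id ?i (coaction A (fst x)) \<oplus>\<^bsub>CD.T\<^esub>
        tensor_map R C ?D id ?j (coaction A (snd x)))"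
      using additive_plus[OF T.abelian_group_axioms, of ?D, OF lmod_hom_additive[OF cip, simplified]
          lmod_hom_additive[OF cjq, simplified]]
      by simp
    fix a x assume a: "a \<in> carrier R" and x: "x \<in> carrier ?D"
    show "tensor_map R C ?D id ?i (coaction A (fst (a \<odot>\<^bsub>?D\<^esub> x))) \<oplus>\<^bsub>CD.T\<^esub> tensor_map R C ?D id ?j
        (coaction A (snd (a \<odot>\<^bsub>?D\<^esub> x)))
      = a \<odot>\<^bsub>tensor R C ?D\<^esub> (tensor_map R C ?D id ?i (coaction A (fst x)) \<oplus>\<^bsub>CD.T\<^esub> tensor_map R C ?D id ?j
          (coaction A (snd x)))"
      using TD.smult_r_distr[OF a lmod_hom_closed[OF cip x] lmod_hom_closed[OF cjq x]]
      by (simp add: lmod_hom_smult[OF cip a x] lmod_hom_smult[OF cjq a x])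
  qed
  \<comment> \<open>On an element in the image of one injection the summand of the coaction
    belonging to the other coordinate vanishes; this makes the injections colinear.\<close>
  have z0: "tensor_map R C ?D id k (coaction A \<zero>\<^bsub>A\<^esub>) = \<zero>\<^bsub>CD.T\<^esub>" if "k \<in> lmod_hom R A ?D" for k
    by (rule additive_zero[OF A.M.abelian_group_axioms T.abelian_group_axioms
        lmod_hom_additive[OF lmod_hom_comp[OF cA tensor_map_id_lmod_hom[OF B LA LD that]], unfolded
            additive_tensor]])
  show ic: "?i \<in> comod_hom R C A ?D"
    by (rule comod_homI[OF i]) (simp add: cpq z0[OF j] lmod_hom_closed[OF ci, simplified])
  show jc: "?j \<in> comod_hom R C A ?D"
    by (rule comod_homI[OF j]) (simp add: cpq z0[OF i] lmod_hom_closed[OF cj, simplified])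
  have gen: "generates ?D {u a | u a. u \<in> {?i, ?j} \<and> a \<in> carrier A}"
    unfolding generates_def
  proof (intro conjI allI impI subsetI)
    fix H x assume H: "{u a | u a. u \<in> {?i, ?j} \<and> a \<in> carrier A} \<subseteq> H \<and> \<zero>\<^bsub>?D\<^esub> \<in> H \<and>
      (\<forall>x\<in>H. \<forall>y\<in>H. x \<oplus>\<^bsub>?D\<^esub> y \<in> H) \<and> (\<forall>x\<in>H. \<forall>y\<in>carrier ?D. x \<oplus>\<^bsub>?D\<^esub> y = \<zero>\<^bsub>?D\<^esub> \<longrightarrow> y \<in> H)"
      and "x \<in> carrier ?D"
    then obtain a b where ab: "a \<in> carrier A" "b \<in> carrier A" "x = (a, b)" by (auto simp: sel)
    have "?i a \<in> H" "?j b \<in> H"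
      using H ab by blast+
    then have "?i a \<oplus>\<^bsub>?D\<^esub> ?j b \<in> H"
      using H by blast
    then show "x \<in> H" using ab by (simp add: sel)
  qed (auto simp: sel)
  show DC: "left_comodule R C ?D"
    by (rule left_comodule_generated[OF A LD cD _ gen]) (use ic jc in auto)
  fix N :: "('a, 'x, 'c, 'y) comodule_scheme" and f g
  show "(\<lambda>(x, y). f x \<oplus>\<^bsub>N\<^esub> g y) \<in> comod_hom R C ?D N"
    if N: "left_comodule R C N" and f: "f \<in> comod_hom R C A N" and g: "g \<in> comod_hom R C A N"
  proof (rule comod_hom_generated[OF A DC N _ gen])
    interpret N: left_module R N by (rule left_comodule_left_module[OF N])
    note fg = comod_hom_lmod_hom[OF f] comod_hom_lmod_hom[OF g]
    note fgp = lmod_hom_comp[OF p fg(1)] lmod_hom_comp[OF q fg(2)]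
    show "(\<lambda>(x, y). f x \<oplus>\<^bsub>N\<^esub> g y) \<in> lmod_hom R ?D N"
      unfolding split_def
      using additive_plus[OF N.M.abelian_group_axioms lmod_hom_additive[OF fgp(1)] lmod_hom_additive[OF
          fgp(2)]]
        lmod_hom_smult[OF fgp(1)] lmod_hom_smult[OF fgp(2)] N.smult_r_distr
        lmod_hom_closed[OF fgp(1)] lmod_hom_closed[OF fgp(2)]
      by (intro lmod_homI) auto
    \<comment> \<open>With these values the induced map restricts along the injections to f and to
      g.\<close>
    have f0: "f \<zero>\<^bsub>A\<^esub> = \<zero>\<^bsub>N\<^esub>" "g \<zero>\<^bsub>A\<^esub> = \<zero>\<^bsub>N\<^esub>"
      using additive_zero[OF A.M.abelian_group_axioms N.M.abelian_group_axioms] fg lmod_hom_additive by blast+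
    show "(\<lambda>a. case u a of (x, y) \<Rightarrow> f x \<oplus>\<^bsub>N\<^esub> g y) \<in> comod_hom R C A N" if "u \<in> {?i, ?j}" for u
      using that comod_hom_cong[OF A N f, of "\<lambda>a. f a \<oplus>\<^bsub>N\<^esub> g \<zero>\<^bsub>A\<^esub>"]
        comod_hom_cong[OF A N g, of "\<lambda>a. f \<zero>\<^bsub>A\<^esub> \<oplus>\<^bsub>N\<^esub> g a"]
      by (auto simp: f0 comod_hom_closed[OF f] comod_hom_closed[OF g])
  qed (use ic jc in auto)
qed


section \<open>The comodule of a tensor product with a module\<close>

text \<open>The tensor product reads its right scalars from \<open>rsmult\<close>, so the family
  \<open>\<sigma>\<close> is packed into a bimodule record, with x s =
  \<open>\<sigma> s x\<close>.\<close>

definition with_right_action :: "('r, 'm, 'q) module_scheme \<Rightarrow> ('s \<Rightarrow> 'm \<Rightarrow> 'm) \<Rightarrow> ('s, 'm) bimodule"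
  where "with_right_action A \<sigma> =
    \<lparr>carrier = carrier A, monoid.mult = undefined, monoid.one = undefined,
      ring.zero = \<zero>\<^bsub>A\<^esub>, ring.add = ring.add A, smult = undefined, rsmult = (\<lambda>x s. \<sigma> s x)\<rparr>"

lemma with_right_action_sel [simp]:
  "carrier (with_right_action A \<sigma>) = carrier A"
  "ring.zero (with_right_action A \<sigma>) = ring.zero A"
  "ring.add (with_right_action A \<sigma>) = ring.add A"
  "rsmult (with_right_action A \<sigma>) x s = \<sigma> s x"
  by (simp_all add: with_right_action_def)

locale comod_right_action =
  fixes R :: "('r, 'o) ring_scheme" and C :: "('r, 'c, 'q) coring_scheme"
    and A :: "('r, 'm, 'c, 'v) comodule_scheme" and S :: "('s, 'w) ring_scheme"
    and B :: "('s, 'b, 'x) module_scheme" and \<sigma> :: "'s \<Rightarrow> 'm \<Rightarrow> 'm"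
  assumes A: "left_comodule R C A" and B: "left_module S B"
    and \<sigma>: "s \<in> carrier S \<Longrightarrow> \<sigma> s \<in> comod_hom R C A A"
begin

abbreviation "A\<sigma> \<equiv> with_right_action A \<sigma>"

lemmas LA = left_comodule_left_module[OF A] and CB = left_comodule_bimodule[OF A]

lemma pair: "tensor_pair S A\<sigma> B"
proof -
  have "abelian_group A\<sigma>"
    by (rule abelian_group_cong[OF left_module_abelian_group[OF LA]]) simp_all
  then show ?thesis
    by (simp add: tensor_pair_def left_module_abelian_group[OF B] left_module.smult_closed[OF B]
        comod_hom_closed[OF \<sigma>])
qed

interpretation AB: tensor_pair S A\<sigma> B by (rule pair)

text \<open>The parameter b comes first, so that each \<open>u b\<close> is a map out of A. These
  are the maps along which the comodule structure of A \<otimes> B is tested.\<close>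

definition u :: "'b \<Rightarrow> 'm \<Rightarrow> ('m, 'b) tensor"
  where "u b a = ptensor S A\<sigma> B a b"

definition tensor_mod :: "('r, ('m, 'b) tensor, 'c) comodule"
  where "tensor_mod = \<lparr>carrier = carrier AB.T, monoid.mult = undefined, monoid.one = undefined,
    ring.zero = \<zero>\<^bsub>AB.T\<^esub>, ring.add = ring.add AB.T,
    smult = (\<lambda>k. tensor_lift AB.T (\<lambda>(a, b). ptensor S A\<sigma> B (k \<odot>\<^bsub>A\<^esub> a) b)), coaction = undefined\<rparr>"

text \<open>This coaction is \<rho> \<otimes> B followed by the identification of (C \<otimes> A)
  \<otimes> B with C \<otimes> (A \<otimes> B). The maps C \<otimes> u b absorb this identification,
  so no associator between tensor products over different rings has to be set up.\<close>

definition tensor_comod :: "('r, ('m, 'b) tensor, 'c) comodule"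
  where "tensor_comod = tensor_mod\<lparr>coaction :=
    tensor_lift (tensor R C tensor_mod) (\<lambda>(a, b). tensor_map R C tensor_mod id (u b) (coaction A a))\<rparr>"

lemma tensor_comod_sel [simp]:
  "carrier tensor_comod = carrier AB.T" "ring.zero tensor_comod = \<zero>\<^bsub>AB.T\<^esub>" "ring.add tensor_comod =
      ring.add AB.T"
  by (simp_all add: tensor_comod_def tensor_mod_def)

lemma coaction_tensor_comod: "coaction tensor_comod =
    tensor_lift (tensor R C tensor_comod) (\<lambda>(a, b). tensor_map R C tensor_comod id (u b) (coaction A a))"
  by (simp add: tensor_comod_def)

lemma additive_tensor_comod [simp]:
  "additive_map tensor_comod N f = additive_map AB.T N f" "additive_map N tensor_comod g = additive_map
      N AB.T g"
  by (simp_all add: additive_map_def)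

lemma smult_commute:
  "k \<in> carrier R \<Longrightarrow> x \<in> carrier A\<sigma> \<Longrightarrow> s \<in> carrier S \<Longrightarrow>
    (k \<odot>\<^bsub>A\<^esub> x) \<odot>\<^sub>r\<^bsub>A\<sigma>\<^esub> s = k \<odot>\<^bsub>A\<^esub> (x \<odot>\<^sub>r\<^bsub>A\<sigma>\<^esub> s)"
  using lmod_hom_smult[OF comod_hom_lmod_hom[OF \<sigma>]] by simp

lemma left_module_tensor_comod: "left_module R tensor_comod"
  by (rule AB.left_module_tensor_group(1)[OF LA _ _ smult_commute])
    (simp_all add: tensor_comod_def tensor_mod_def)

lemma smult_u: "k \<in> carrier R \<Longrightarrow> a \<in> carrier A \<Longrightarrow> b \<in> carrier B \<Longrightarrow> k \<odot>\<^bsub>tensor_comod\<^esub> u b a = u b (k \<odot>\<^bsub>A\<^esub> a)"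
  unfolding u_def
  by (rule AB.left_module_tensor_group(2)[OF LA _ _ smult_commute])
    (simp_all add: tensor_comod_def tensor_mod_def)

lemma u_closed: "a \<in> carrier A \<Longrightarrow> b \<in> carrier B \<Longrightarrow> u b a \<in> carrier AB.T"
  by (simp add: u_def AB.ptensor_closed)

lemma u_add_left:
  "a \<in> carrier A \<Longrightarrow> b \<in> carrier B \<Longrightarrow> b' \<in> carrier B \<Longrightarrow> u (b \<oplus>\<^bsub>B\<^esub> b') a = u b a \<oplus>\<^bsub>tensor_comod\<^esub> u b' a"
  by (simp add: u_def AB.ptensor_add_right)

lemma u_smult: "a \<in> carrier A \<Longrightarrow> b \<in> carrier B \<Longrightarrow> s \<in> carrier S \<Longrightarrow> u (s \<odot>\<^bsub>B\<^esub> b) a = u b (\<sigma> s a)"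
  using AB.ptensor_balanced[of a s b] by (simp add: u_def)

lemma u_lmod_hom: "b \<in> carrier B \<Longrightarrow> u b \<in> lmod_hom R A tensor_comod"
  using AB.ptensor_additive_left[of b]
  by (intro lmod_homI) (simp_all add: smult_u u_closed additive_map_def Pi_iff, simp add: u_def)

interpretation CT: tensor_pair R C tensor_comod
  by (rule tensor_pairI[OF CB left_module_tensor_comod])

text \<open>Additivity in a and in b comes from the coaction of A and from additivity of C \<otimes>
  -. Balancing over S is where compatibility of \<open>\<sigma> s\<close> with the coaction
  enters.\<close>

lemma coaction_balanced:
  "balanced S A\<sigma> B (tensor R C tensor_comod) (\<lambda>(a, b). tensor_map R C tensor_comod id (u b) (coaction A a))"
proof (rule balancedI; simp only: prod.case additive_tensor with_right_action_sel)
  have pairs: "tensor_pair R C A" "tensor_pair R C tensor_comod"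
    by (rule tensor_pairI[OF CB LA], rule CT.tensor_pair_axioms)
  fix b assume b: "b \<in> carrier B"
  have "additive_map A CT.T (\<lambda>a. tensor_map R C tensor_comod id (u b) (coaction A a))"
    by (rule additive_comp[OF coaction_additive[OF A] tensor_map_additive[OF pairs rmod_hom_id
        u_lmod_hom[OF b]]])
  then show "additive_map A\<sigma> CT.T (\<lambda>a. tensor_map R C tensor_comod id (u b) (coaction A a))"
    by (simp add: additive_map_def)
next
  fix a assume a: "a \<in> carrier A"
  note ca = coaction_closed[OF A a]
  note LT = left_module_tensor_comod
  have pairs: "tensor_pair R C A" "tensor_pair R C tensor_comod"
    by (rule tensor_pairI[OF CB LA], rule CT.tensor_pair_axioms)
  show "additive_map B CT.T (\<lambda>b. tensor_map R C tensor_comod id (u b) (coaction A a))"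
  proof (rule additiveI)
    fix b assume "b \<in> carrier B"
    then show "tensor_map R C tensor_comod id (u b) (coaction A a) \<in> carrier CT.T"
      by (rule additive_closed[OF tensor_map_additive[OF pairs rmod_hom_id u_lmod_hom] ca])
  next
    fix b b' assume b: "b \<in> carrier B" "b' \<in> carrier B"
    then have "b \<oplus>\<^bsub>B\<^esub> b' \<in> carrier B"
      using left_module_abelian_group[OF B] by (simp add: abelian_group_def abelian_monoid.a_closed)
    from tensor_map_id_plus[OF CB LA LT u_lmod_hom[OF b(1)] u_lmod_hom[OF b(2)] u_lmod_hom[OF this]
        u_add_left[OF _ b] ca]
    show "tensor_map R C tensor_comod id (u (b \<oplus>\<^bsub>B\<^esub> b')) (coaction A a) =
      tensor_map R C tensor_comod id (u b) (coaction A a) \<oplus>\<^bsub>CT.T\<^esub> tensor_map R C tensor_comod id (u b')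
          (coaction A a)" .
  qed
next
  fix a s b assume a: "a \<in> carrier A" and s: "s \<in> carrier S" and b: "b \<in> carrier B"
  note ca = coaction_closed[OF A a] and LT = left_module_tensor_comod
  note \<sigma>l = comod_hom_lmod_hom[OF \<sigma>[OF s]]
  have sb: "s \<odot>\<^bsub>B\<^esub> b \<in> carrier B" by (rule left_module.smult_closed[OF B s b])
  have "tensor_map R C tensor_comod id (u b) (coaction A (\<sigma> s a)) =
      tensor_map R C tensor_comod id (\<lambda>a. u b (\<sigma> s a)) (coaction A a)"
    by (simp add: comod_hom_coaction[OF \<sigma>[OF s] a] tensor_map_id_comp[OF CB LA LA LT \<sigma>l u_lmod_hom[OF b] ca])
  also have "\<dots> = tensor_map R C tensor_comod id (u (s \<odot>\<^bsub>B\<^esub> b)) (coaction A a)"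
    by (rule tensor_map_id_cong[OF CB LA LT lmod_hom_comp[OF \<sigma>l u_lmod_hom[OF b]] u_lmod_hom[OF sb] _ ca])
      (simp add: u_smult b s)
  finally show "tensor_map R C tensor_comod id (u b) (coaction A (\<sigma> s a)) =
      tensor_map R C tensor_comod id (u (s \<odot>\<^bsub>B\<^esub> b)) (coaction A a)" .
qed

lemma coaction_u:
  "a \<in> carrier A \<Longrightarrow> b \<in> carrier B \<Longrightarrow>
    coaction tensor_comod (u b a) = tensor_map R C tensor_comod id (u b) (coaction A a)"
  unfolding coaction_tensor_comod u_def[of b a]
  using AB.tensor_lift_ptensor[OF CT.abelian_group_tensor coaction_balanced] by simp

lemma coaction_tensor_comod_hom: "coaction tensor_comod \<in> lmod_hom R tensor_comod (tensor R C tensor_comod)"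
proof (rule lmod_homI)
  have add: "additive_map AB.T CT.T (coaction tensor_comod)"
    using AB.tensor_lift_additive[OF CT.abelian_group_tensor coaction_balanced]
    unfolding coaction_tensor_comod by simp
  then show "additive_map tensor_comod (tensor R C tensor_comod) (coaction tensor_comod)"
    by simp
  note LT = left_module_tensor_comod
  fix k t assume k: "k \<in> carrier R" and "t \<in> carrier tensor_comod"
  then have t: "t \<in> carrier AB.T" by simp
  have s: "additive_map AB.T AB.T (\<lambda>t. k \<odot>\<^bsub>tensor_comod\<^esub> t)"
    "additive_map CT.T CT.T (\<lambda>t. k \<odot>\<^bsub>tensor R C tensor_comod\<^esub> t)"
    using smult_additive[OF LT k] smult_additive[OF tensor_left_module(1)[OF CB LT] k] by simp_all
  show "coaction tensor_comod (k \<odot>\<^bsub>tensor_comod\<^esub> t) = k \<odot>\<^bsub>tensor R C tensor_comod\<^esub> coaction tensor_comod t"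
  proof (rule AB.tensor_eqI[OF CT.abelian_group_tensor_group additive_comp[OF s(1) add] additive_comp[OF
      add s(2)] _ t])
    fix a b assume "a \<in> carrier A\<sigma>" and b: "b \<in> carrier B"
    then have a: "a \<in> carrier A" by simp
    note ka = left_module.smult_closed[OF LA k a]
    note cA = left_comodule.coaction_hom[OF A]
    show "coaction tensor_comod (k \<odot>\<^bsub>tensor_comod\<^esub> ptensor S A\<sigma> B a b) =
        k \<odot>\<^bsub>tensor R C tensor_comod\<^esub> coaction tensor_comod (ptensor S A\<sigma> B a b)"
      using lmod_hom_smult[OF lmod_hom_comp[OF cA tensor_map_id_lmod_hom[OF CB LA LT u_lmod_hom[OF b]]] k a]
      unfolding u_def[symmetric] by (simp add: smult_u[OF k a b] coaction_u[OF ka b] coaction_u[OF a b])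
  qed
qed

lemma u_comod_hom: "b \<in> carrier B \<Longrightarrow> u b \<in> comod_hom R C A tensor_comod"
  by (intro comod_homI u_lmod_hom) (simp_all add: coaction_u)

lemma generates_u: "generates tensor_comod {v a | v a. v \<in> u ` carrier B \<and> a \<in> carrier A}"
proof -
  have "{v a | v a. v \<in> u ` carrier B \<and> a \<in> carrier A} = {ptensor S A\<sigma> B x y | x y. x \<in> carrier A\<sigma> \<and> y \<in>
      carrier B}"
    unfolding u_def[symmetric] with_right_action_sel by blast
  then show ?thesis
    using AB.generates_ptensor by (simp add: generates_def)
qed

lemma left_comodule_tensor_comod: "left_comodule R C tensor_comod"
  by (rule left_comodule_generated[OF A left_module_tensor_comod coaction_tensor_comod_hom _ generates_u])
    (auto intro: u_comod_hom)

lemma tensor_comod_eqI: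
  assumes N: "left_comodule R C N" and f: "f \<in> comod_hom R C tensor_comod N" and g: "g \<in> comod_hom R C
      tensor_comod N"
    and "\<And>a b. a \<in> carrier A \<Longrightarrow> b \<in> carrier B \<Longrightarrow> f (u b a) = g (u b a)" and "t \<in> carrier tensor_comod"
  shows "f t = g t"
  by (rule additive_eqI[OF generates_u left_comodule_abelian_group[OF left_comodule_tensor_comod]
        left_comodule_abelian_group[OF N] lmod_hom_additive[OF comod_hom_lmod_hom[OF f]]
        lmod_hom_additive[OF comod_hom_lmod_hom[OF g]] _ assms(5)]) (use assms(4) in auto)

text \<open>With \<open>tensor_comod_eqI\<close> for uniqueness this is the tensor-hom adjunction:
  maps A \<otimes> B \<rightarrow> N correspond to additive families f b of maps A \<rightarrow> N
  in which s acts by precomposition with \<open>\<sigma> s\<close>.\<close>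

lemma tensor_comod_lift:
  assumes N: "left_comodule R C N" and f: "\<And>b. b \<in> carrier B \<Longrightarrow> f b \<in> comod_hom R C A N"
    and f_add: "\<And>a b b'. a \<in> carrier A \<Longrightarrow> b \<in> carrier B \<Longrightarrow> b' \<in> carrier B \<Longrightarrow>
      f (b \<oplus>\<^bsub>B\<^esub> b') a = f b a \<oplus>\<^bsub>N\<^esub> f b' a"
    and f_smult: "\<And>a b s. a \<in> carrier A \<Longrightarrow> b \<in> carrier B \<Longrightarrow> s \<in> carrier S \<Longrightarrow> f (s \<odot>\<^bsub>B\<^esub> b) a = f b (\<sigma> s a)"
  obtains h where "h \<in> comod_hom R C tensor_comod N"
    "\<And>a b. a \<in> carrier A \<Longrightarrow> b \<in> carrier B \<Longrightarrow> h (u b a) = f b a"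
proof -
  note LN = left_comodule_left_module[OF N] and GN = left_comodule_abelian_group[OF N]
  let ?f = "\<lambda>(a, b). f b a"
  have bal: "balanced S A\<sigma> B N ?f"
  proof (rule balancedI; simp only: prod.case with_right_action_sel)
    fix b assume "b \<in> carrier B"
    from lmod_hom_additive[OF comod_hom_lmod_hom[OF f[OF this]]]
    show "additive_map A\<sigma> N (f b)" by (simp add: additive_map_def)
  qed (auto intro!: additiveI simp: f_add f_smult comod_hom_closed[OF f])
  define h where "h = tensor_lift N ?f"
  have add: "additive_map AB.T N h"
    unfolding h_def by (rule AB.tensor_lift_additive[OF GN bal])
  have hu: "h (u b a) = f b a" if "a \<in> carrier A" "b \<in> carrier B" for a b
    using AB.tensor_lift_ptensor[OF GN bal, of a b] that by (simp add: h_def u_def)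
  have hl: "h \<in> lmod_hom R tensor_comod N"
  proof (rule lmod_homI)
    show "additive_map tensor_comod N h" using add by simp
    fix k t assume k: "k \<in> carrier R" and t: "t \<in> carrier tensor_comod"
    have s: "additive_map AB.T AB.T (\<lambda>t. k \<odot>\<^bsub>tensor_comod\<^esub> t)"
      using smult_additive[OF left_module_tensor_comod k] by simp
    show "h (k \<odot>\<^bsub>tensor_comod\<^esub> t) = k \<odot>\<^bsub>N\<^esub> h t"
      by (rule AB.tensor_eqI[OF GN additive_comp[OF s add] additive_comp[OF add smult_additive[OF LN k]]])
        (use k t in \<open>simp_all add: u_def[symmetric] smult_u hu left_module.smult_closed[OF LA]
            lmod_hom_smult[OF comod_hom_lmod_hom[OF f]]\<close>)
  qed
  \<comment> \<open>Along \<open>u b\<close> the lift is \<open>f b\<close>, which is colinear by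
    assumption.\<close>
  have "h \<in> comod_hom R C tensor_comod N"
    by (rule comod_hom_generated[OF A left_comodule_tensor_comod N _ generates_u hl])
      (auto intro!: u_comod_hom comod_hom_cong[OF A N f] simp: hu)
  then show ?thesis
    using that hu by blast
qed

end

section \<open>Cardinality bounds\<close>

text \<open>The tensor product is a quotient of a free abelian group, and a free abelian group on an
  infinite set has the size of that set.\<close>

lemma tensor_group_lepoll:
  fixes M :: "('r, 'u, 'p) bimodule_scheme" and N :: "('r, 'u, 'q) module_scheme" and W :: "'u set"
  assumes W: "infinite W" and M: "lepoll (carrier M) W" and N: "lepoll (carrier N) W"
  shows "lepoll (carrier (tensor_group R M N)) W"
proof -
  have WW: "lepoll (W \<times> W) W"
    using card_of_Times_same_infinite[OF W] by (simp add: eqpoll_imp_lepoll eqpoll_iff_card_of_ordIso)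
  have MN: "lepoll (carrier M \<times> carrier N) W"
    using times_lepoll_mono[OF M N] WW by (rule lepoll_trans)
  \<comment> \<open>The carriers may be finite. Adjoining W \<times> W makes the basis infinite
    without letting it grow beyond the size of \<open>W\<close>.\<close>
  let ?Y = "carrier M \<times> carrier N \<union> W \<times> W"
  have Y: "infinite ?Y"
    using W by (auto simp: finite_cartesian_product_iff)
  have "lepoll ?Y W"
    using card_of_Un_ordLeq_infinite[OF W] MN WW by (simp add: lepoll_def card_of_ordLeq)
  have "lepoll (carrier (tensor_group R M N)) (carrier (tensor_free M N))"
    by (rule subset_image_lepoll[where f = "\<lambda>z. tensor_rels R M N #>\<^bsub>tensor_free M N\<^esub> z"])
      (auto simp: tensor_group_def FactGroup_def RCOSETS_def)
  also have "lepoll \<dots> (carrier (free_Abelian_group ?Y))"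
    by (rule subset_imp_lepoll) (auto simp: tensor_free_def)
  also have "lepoll \<dots> (?Y)"
    by (rule eqpoll_imp_lepoll[OF eqpoll_free_Abelian_group_infinite[OF Y]])
  also have "lepoll \<dots> (W)" by fact
  finally show ?thesis .
qed

text \<open>Cardinalities are comparable, so the largest of K, L and an infinite member of the
  universe serves as W.\<close>

lemma universe_common_bound:
  assumes U: "universe \<U>" and "K \<in> \<U>" "L \<in> \<U>"
  obtains W where "W \<in> \<U>" "infinite W" "lepoll K W" "lepoll L W"
proof -
  have lin: "lepoll K L \<or> lepoll L K" for K L :: "'a set"
    by (metis card_of_Well_order ordLeq_total card_of_ordLeq lepoll_def)
  obtain Z where Z: "Z \<in> \<U>" "infinite Z"
    using U by (auto simp: universe_def)
  obtain W1 where W1: "W1 \<in> \<U>" "infinite W1" "lepoll K W1"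
    using lin[of K Z] Z \<open>K \<in> \<U>\<close> by (metis infinite_le_lepoll lepoll_refl lepoll_trans)
  show ?thesis
    using lin[of L W1] W1 \<open>L \<in> \<U>\<close> that by (metis infinite_le_lepoll lepoll_refl lepoll_trans)
qed

lemma universe_closed: "universe \<U> \<Longrightarrow> W \<in> \<U> \<Longrightarrow> lepoll K W \<Longrightarrow> K \<in> \<U>"
  by (auto simp: universe_def)


section \<open>Representable functors\<close>

locale comodule_representation =
  fixes \<U> :: "'u set set" and R :: "'r ring" and C :: "('r, 'c) coring" and S :: "'s ring"
    and F :: "(('r, 'u, 'c) comodule, 'u \<Rightarrow> 'u, ('s, 'u) module, 'u \<Rightarrow> 'u) fctr"
    and A :: "('r, 'u, 'c) comodule" and \<phi> :: "('r, 'u, 'c) comodule \<Rightarrow> ('u \<Rightarrow> 'u) \<Rightarrow> 'u"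
  assumes universe: "universe \<U>"
    and F_functor: "is_functor (Comod_cat \<U> R C) (Mod_cat \<U> S) F"
    and A_obj: "A \<in> Obj (Comod_cat \<U> R C)"
    and \<phi>_bij: "M \<in> Obj (Comod_cat \<U> R C) \<Longrightarrow>
      bij_betw (\<phi> M) (Hom (Comod_cat \<U> R C) A M) (carrier (fobj F M))"
    and \<phi>_nat: "M \<in> Obj (Comod_cat \<U> R C) \<Longrightarrow> N \<in> Obj (Comod_cat \<U> R C) \<Longrightarrow>
      f \<in> Hom (Comod_cat \<U> R C) M N \<Longrightarrow> h \<in> Hom (Comod_cat \<U> R C) A M \<Longrightarrow>
      \<phi> N (Comp (Comod_cat \<U> R C) A M N f h) = fmap F M N f (\<phi> M h)"
begin

abbreviation obj :: "('r, 'u, 'c) comodule \<Rightarrow> bool"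
  where "obj M \<equiv> M \<in> Obj (Comod_cat \<U> R C)"

abbreviation hom :: "('r, 'u, 'c) comodule \<Rightarrow> ('r, 'u, 'c) comodule \<Rightarrow> ('u \<Rightarrow> 'u) set"
  where "hom M N \<equiv> comod_hom R C M N"

lemma obj_iff: "obj M \<longleftrightarrow> left_comodule R C M \<and> carrier M \<in> \<U>"
  by (simp add: Comod_cat_def)

lemma obj_comodule: "obj M \<Longrightarrow> left_comodule R C M"
  by (simp add: obj_iff)

lemmas A_comodule = obj_comodule[OF A_obj]

lemma Hom_iff: "f \<in> Hom (Comod_cat \<U> R C) M N \<longleftrightarrow> f \<in> hom M N \<and> f \<in> extensional (carrier M)"
  by (simp add: Comod_cat_def)

lemma restrict_Hom: "obj M \<Longrightarrow> obj N \<Longrightarrow> f \<in> hom M N \<Longrightarrow> restrict f (carrier M) \<in> Hom (Comod_cat \<U> R C) M N"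
  by (auto simp: Hom_iff intro: comod_hom_cong[of R C M N f] obj_comodule)

lemma F_module: "obj M \<Longrightarrow> left_module S (fobj F M)"
  using F_functor by (simp add: is_functor_def Mod_cat_def)

lemma F_map: "obj M \<Longrightarrow> obj N \<Longrightarrow> f \<in> hom M N \<Longrightarrow>
    fmap F M N (restrict f (carrier M)) \<in> lmod_hom S (fobj F M) (fobj F N)"
  using F_functor restrict_Hom[of M N f] by (auto simp: is_functor_def Mod_cat_def)

text \<open>The representing bijection, on homomorphisms that need not be extensional.\<close>

definition \<Phi> :: "('r, 'u, 'c) comodule \<Rightarrow> ('u \<Rightarrow> 'u) \<Rightarrow> 'u"
  where "\<Phi> M f = \<phi> M (restrict f (carrier A))"

lemma \<Phi>_closed: "obj M \<Longrightarrow> f \<in> hom A M \<Longrightarrow> \<Phi> M f \<in> carrier (fobj F M)"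
  unfolding \<Phi>_def using restrict_Hom[OF A_obj] \<phi>_bij by (blast dest: bij_betwE)

lemma \<Phi>_cong: "(\<And>x. x \<in> carrier A \<Longrightarrow> f x = g x) \<Longrightarrow> \<Phi> M f = \<Phi> M g"
  unfolding \<Phi>_def by (metis restrict_ext)

lemma \<Phi>_inj:
  assumes M: "obj M" and f: "f \<in> hom A M" and g: "g \<in> hom A M" and eq: "\<Phi> M f = \<Phi> M g" and x: "x \<in> carrier A"
  shows "f x = g x"
proof -
  have "restrict f (carrier A) = restrict g (carrier A)"
    using inj_onD[OF bij_betw_imp_inj_on[OF \<phi>_bij[OF M]] _ restrict_Hom[OF A_obj M f] restrict_Hom[OF
        A_obj M g]] eq
    by (simp add: \<Phi>_def)
  then show ?thesis
    using x by (metis restrict_apply')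
qed

lemma \<Phi>_surj:
  assumes "obj M" "y \<in> carrier (fobj F M)"
  obtains f where "f \<in> hom A M" "\<Phi> M f = y"
proof -
  from assms(2) have "y \<in> \<phi> M ` Hom (Comod_cat \<U> R C) A M"
    using \<phi>_bij[OF assms(1)] by (simp add: bij_betw_def)
  then obtain f where f: "f \<in> Hom (Comod_cat \<U> R C) A M" "\<phi> M f = y"
    by blast
  then have "\<Phi> M f = y"
    by (simp add: \<Phi>_def Hom_iff extensional_restrict)
  with f that show ?thesis by (auto simp: Hom_iff)
qed

lemma \<Phi>_nat:
  assumes M: "obj M" and N: "obj N" and f: "f \<in> hom M N" and h: "h \<in> hom A M"
  shows "\<Phi> N (\<lambda>x. f (h x)) = fmap F M N (restrict f (carrier M)) (\<Phi> M h)"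
proof -
  have "restrict (\<lambda>x. f (h x)) (carrier A) =
      compose (carrier A) (restrict f (carrier M)) (restrict h (carrier A))"
    by (auto simp: fun_eq_iff compose_def comod_hom_closed[OF h])
  also have "\<dots> = Comp (Comod_cat \<U> R C) A M N (restrict f (carrier M)) (restrict h (carrier A))"
    by (simp add: Comod_cat_def)
  finally show ?thesis
    unfolding \<Phi>_def by (simp add: \<phi>_nat[OF M N restrict_Hom[OF M N f] restrict_Hom[OF A_obj M h]])
qed

text \<open>Let z represent the zero of F A. The zero map A \<rightarrow> M absorbs z, so it
  represents the image of 0 under F applied to the zero map, and that image is 0 by
  additivity.\<close>

lemma \<Phi>_zero:
  assumes M: "obj M"
  shows "\<Phi> M (\<lambda>x. \<zero>\<^bsub>M\<^esub>) = \<zero>\<^bsub>fobj F M\<^esub>"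
proof -
  interpret FA: left_module S "fobj F A" by (rule F_module[OF A_obj])
  obtain z where z: "z \<in> hom A A" "\<Phi> A z = \<zero>\<^bsub>fobj F A\<^esub>"
    using \<Phi>_surj[OF A_obj FA.M.zero_closed] by blast
  have 0: "(\<lambda>x. \<zero>\<^bsub>M\<^esub>) \<in> hom A M"
    by (rule zero_comod_hom[OF A_comodule obj_comodule[OF M]])
  show ?thesis
    using \<Phi>_nat[OF A_obj M 0 z(1)] z(2)
      additive_zero[OF FA.M.abelian_group_axioms left_module_abelian_group[OF F_module[OF M]]
        lmod_hom_additive[OF F_map[OF A_obj M 0]]]
    by simp
qed

lemma obj_transport:
  fixes P :: "('r, 'p, 'c) comodule"
  assumes P: "left_comodule R C P" and W: "W \<in> \<U>" "lepoll (carrier P) W"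
  obtains Q and e :: "'p \<Rightarrow> 'u" and e' where "obj Q" "carrier Q = e ` carrier P"
    "e \<in> comod_hom R C P Q" "e' \<in> comod_hom R C Q P" "\<And>x. x \<in> carrier P \<Longrightarrow> e' (e x) = x"
proof -
  obtain e where e: "inj_on e (carrier P)" "e ` carrier P \<subseteq> W"
    using W(2) by (auto simp: lepoll_def)
  obtain Q :: "('r, 'u, 'c) comodule" where Q: "left_comodule R C Q" "carrier Q = e ` carrier P"
    "e \<in> comod_hom R C P Q" "inv_into (carrier P) e \<in> comod_hom R C Q P"
    using left_comodule_transport[OF P e(1)] by metis
  have "obj Q"
    unfolding obj_iff using Q universe_closed[OF universe W(1) subset_imp_lepoll[OF e(2)]] by simp
  with Q that[of Q e] e(1) show ?thesis by simp
qed

text \<open>Eckmann-Hilton: the sum of the two injections into \<open>A \<oplus> A\<close>, formed in \<open>F (A \<oplus> A)\<close>,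
  is represented by a map \<open>A \<rightarrow> A \<oplus> A\<close> with both projections the identity, that is, by the diagonal.\<close>

lemma \<Phi>_add:
  assumes M: "obj M" and f: "f \<in> hom A M" and g: "g \<in> hom A M"
  shows "(\<lambda>x. f x \<oplus>\<^bsub>M\<^esub> g x) \<in> hom A M"
    and "\<Phi> M (\<lambda>x. f x \<oplus>\<^bsub>M\<^esub> g x) = \<Phi> M f \<oplus>\<^bsub>fobj F M\<^esub> \<Phi> M g"
proof -
  let ?D = "comod_biproduct R C A"
  note D = comod_biproduct[OF A_comodule]
  interpret A: left_module R A by (rule left_comodule_left_module[OF A_comodule])
  have "carrier A \<in> \<U>" using A_obj by (simp add: obj_iff)
  then obtain W where W: "W \<in> \<U>" "infinite W" "lepoll (carrier A) W"
    using universe_common_bound[OF universe] by metis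
  have "lepoll (carrier ?D) (W \<times> W)"
    unfolding comod_biproduct_sel by (rule times_lepoll_mono[OF W(3,3)])
  also have "lepoll (W \<times> W) W"
    using card_of_Times_same_infinite[OF W(2)] by (simp add: eqpoll_imp_lepoll eqpoll_iff_card_of_ordIso)
  finally have "lepoll (carrier ?D) W" .
  then obtain Q e e' where Q: "obj Q" "carrier Q = e ` carrier ?D" and e: "e \<in> comod_hom R C ?D Q"
    and e': "e' \<in> comod_hom R C Q ?D" and e'e: "\<And>x. x \<in> carrier ?D \<Longrightarrow> e' (e x) = x"
    using obj_transport[OF D(1) W(1)] by metis
  note QC = obj_comodule[OF Q(1)]
  define i where "i x = e (x, \<zero>\<^bsub>A\<^esub>)" for x
  define j where "j x = e (\<zero>\<^bsub>A\<^esub>, x)" for x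
  \<comment> \<open>\<open>cp N f g\<close> is the map out of the biproduct that is f on the first
    summand and g on the second, read on the copy \<open>Q\<close>.\<close>
  define cp where "cp N f g x = (case e' x of (x, y) \<Rightarrow> f x \<oplus>\<^bsub>N\<^esub> g y)"
    for N :: "('r, 'u, 'c) comodule" and f g x
  have i: "i \<in> hom A Q" and j: "j \<in> hom A Q"
    unfolding i_def[abs_def] j_def[abs_def]
    by (rule comod_hom_comp[OF A_comodule D(1) QC D(2) e], rule comod_hom_comp[OF A_comodule D(1) QC D(3) e])
  have cp: "cp N f g \<in> hom Q N" if "obj N" "f \<in> hom A N" "g \<in> hom A N" for N f g
    unfolding cp_def[abs_def]
    using comod_hom_comp[OF QC D(1) obj_comodule e' D(4)[OF obj_comodule]] that by simp
  have cp_e: "cp N f g (e (x, y)) = f x \<oplus>\<^bsub>N\<^esub> g y" if "x \<in> carrier A" "y \<in> carrier A" for N f g x y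
    using that by (simp add: cp_def e'e comod_biproduct_sel)
  obtain \<mu> where \<mu>: "\<mu> \<in> hom A Q" "\<Phi> Q \<mu> = \<Phi> Q i \<oplus>\<^bsub>fobj F Q\<^esub> \<Phi> Q j"
  proof (rule \<Phi>_surj[OF Q(1)])
    show "\<Phi> Q i \<oplus>\<^bsub>fobj F Q\<^esub> \<Phi> Q j \<in> carrier (fobj F Q)"
      using F_module[OF Q(1), THEN left_module_abelian_group] \<Phi>_closed[OF Q(1) i] \<Phi>_closed[OF Q(1) j]
      by (simp add: abelian_group_def abelian_monoid.a_closed)
  qed
  \<comment> \<open>F applied to \<open>cp N f g\<close> is additive and sends the elements
    represented by i and j to those represented by f and g; hence it sends the element represented
    by \<open>\<mu>\<close> to their sum.\<close>
  have main: "\<Phi> N (\<lambda>x. cp N f g (\<mu> x)) = \<Phi> N f \<oplus>\<^bsub>fobj F N\<^esub> \<Phi> N g"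
    if N: "obj N" and f: "f \<in> hom A N" and g: "g \<in> hom A N" for N f g
  proof -
    interpret N: left_module R N by (rule left_comodule_left_module[OF obj_comodule[OF N]])
    have z: "f \<zero>\<^bsub>A\<^esub> = \<zero>\<^bsub>N\<^esub>" "g \<zero>\<^bsub>A\<^esub> = \<zero>\<^bsub>N\<^esub>"
      using additive_zero[OF A.M.abelian_group_axioms N.M.abelian_group_axioms
          lmod_hom_additive[OF comod_hom_lmod_hom]] f g by blast+
    note c = cp[OF N f g] and nat = \<Phi>_nat[OF Q(1) N cp[OF N f g]]
    have "\<Phi> N (\<lambda>x. cp N f g (\<mu> x)) = \<Phi> N (\<lambda>x. cp N f g (i x)) \<oplus>\<^bsub>fobj F N\<^esub> \<Phi> N (\<lambda>x. cp N f g (j x))"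
      using lmod_hom_add[OF F_map[OF Q(1) N c] \<Phi>_closed[OF Q(1) i] \<Phi>_closed[OF Q(1) j]]
      by (simp add: nat[OF \<mu>(1)] nat[OF i] nat[OF j] \<mu>(2))
    moreover have "\<Phi> N (\<lambda>x. cp N f g (i x)) = \<Phi> N f"
      by (rule \<Phi>_cong) (simp add: i_def cp_e z comod_hom_closed[OF f])
    moreover have "\<Phi> N (\<lambda>x. cp N f g (j x)) = \<Phi> N g"
      by (rule \<Phi>_cong) (simp add: j_def cp_e z comod_hom_closed[OF g])
    ultimately show ?thesis by simp
  qed
  interpret FA: left_module S "fobj F A" by (rule F_module[OF A_obj])
  note id = comod_hom_id[OF A_comodule] and 0 = zero_comod_hom[OF A_comodule A_comodule]
  have diag: "\<mu> x = e (x, x)" if x: "x \<in> carrier A" for x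
  proof -
    obtain a b where ab: "a \<in> carrier A" "b \<in> carrier A" "\<mu> x = e (a, b)"
      using comod_hom_closed[OF \<mu>(1) x] by (auto simp: Q(2) comod_biproduct_sel)
    \<comment> \<open>Pairing the identity with zero is the first projection. By \<open>main\<close>
      its composite with \<open>\<mu>\<close> represents the same element as the identity, and
      \<open>\<Phi>\<close> is injective.\<close>
    have "cp A (\<lambda>x. x) (\<lambda>x. \<zero>\<^bsub>A\<^esub>) (\<mu> x) = x"
      by (rule \<Phi>_inj[OF A_obj comod_hom_comp[OF A_comodule QC A_comodule \<mu>(1) cp[OF A_obj id 0]] id _ x])
        (simp add: main[OF A_obj id 0] \<Phi>_zero[OF A_obj] \<Phi>_closed[OF A_obj id])
    moreover have "cp A (\<lambda>x. \<zero>\<^bsub>A\<^esub>) (\<lambda>x. x) (\<mu> x) = x"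
      by (rule \<Phi>_inj[OF A_obj comod_hom_comp[OF A_comodule QC A_comodule \<mu>(1) cp[OF A_obj 0 id]] id _ x])
        (simp add: main[OF A_obj 0 id] \<Phi>_zero[OF A_obj] \<Phi>_closed[OF A_obj id])
    ultimately show ?thesis
      using ab by (simp add: cp_e)
  qed
  \<comment> \<open>Since \<open>\<mu>\<close> is the diagonal, the pointwise sum is a composite of
    comodule maps. This gives at once that it is a comodule map and, by \<open>main\<close>, which
    element it represents.\<close>
  have eq: "f x \<oplus>\<^bsub>M\<^esub> g x = cp M f g (\<mu> x)" if "x \<in> carrier A" for x
    using that by (simp add: diag cp_e)
  show "(\<lambda>x. f x \<oplus>\<^bsub>M\<^esub> g x) \<in> hom A M"
    by (rule comod_hom_cong[OF A_comodule obj_comodule[OF M]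
          comod_hom_comp[OF A_comodule QC obj_comodule[OF M] \<mu>(1) cp[OF M f g]] eq])
  show "\<Phi> M (\<lambda>x. f x \<oplus>\<^bsub>M\<^esub> g x) = \<Phi> M f \<oplus>\<^bsub>fobj F M\<^esub> \<Phi> M g"
    using main[OF M f g] \<Phi>_cong[OF eq] by simp
qed

section \<open>The right action of S and the representing comodule\<close>

text \<open>The action of s is natural in M, so by Yoneda it is determined by its value on the
  universal element \<open>\<Phi> A (\<lambda>x. x)\<close>; \<open>act s\<close> is an endomorphism
  representing that value.\<close>

definition act :: "'s \<Rightarrow> 'u \<Rightarrow> 'u"
  where "act s = (SOME f. f \<in> hom A A \<and> \<Phi> A f = s \<odot>\<^bsub>fobj F A\<^esub> \<Phi> A (\<lambda>x. x))"

lemma act: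
  assumes "s \<in> carrier S"
  shows "act s \<in> hom A A" "\<Phi> A (act s) = s \<odot>\<^bsub>fobj F A\<^esub> \<Phi> A (\<lambda>x. x)"
proof -
  have "s \<odot>\<^bsub>fobj F A\<^esub> \<Phi> A (\<lambda>x. x) \<in> carrier (fobj F A)"
    by (rule left_module.smult_closed[OF F_module[OF A_obj] assms \<Phi>_closed[OF A_obj comod_hom_id[OF
        A_comodule]]])
  from \<Phi>_surj[OF A_obj this] have "\<exists>f. f \<in> hom A A \<and> \<Phi> A f = s \<odot>\<^bsub>fobj F A\<^esub> \<Phi> A (\<lambda>x. x)"
    by blast
  from someI_ex[OF this] show "act s \<in> hom A A" "\<Phi> A (act s) = s \<odot>\<^bsub>fobj F A\<^esub> \<Phi> A (\<lambda>x. x)"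
    unfolding act_def by auto
qed

text \<open>By naturality the left side is F f applied to s times the universal element. F f is
  S-linear and sends the universal element to \<open>\<Phi> M f\<close>.\<close>

lemma \<Phi>_smult:
  assumes M: "obj M" and f: "f \<in> hom A M" and s: "s \<in> carrier S"
  shows "\<Phi> M (\<lambda>x. f (act s x)) = s \<odot>\<^bsub>fobj F M\<^esub> \<Phi> M f"
  using \<Phi>_nat[OF A_obj M f act(1)[OF s]] \<Phi>_nat[OF A_obj M f comod_hom_id[OF A_comodule]]
    lmod_hom_smult[OF F_map[OF A_obj M f] s \<Phi>_closed[OF A_obj comod_hom_id[OF A_comodule]]]
  by (simp add: act(2)[OF s])

text \<open>This is the tensor-hom adjunction read through \<open>\<Phi>\<close>: a map h on A
  \<otimes> B goes to the family of its restrictions to A, one for each b, and \<open>\<Phi>\<close>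
  turns each restriction into an element of F M. \<open>\<Phi>_add\<close> and
  \<open>\<Phi>_smult\<close> make the resulting map B \<rightarrow> F M linear.\<close>

lemma Hom_representable:
  assumes B: "B \<in> Obj (Mod_cat \<U> S)"
  obtains Q \<theta> where "obj Q"
    "\<And>M. obj M \<Longrightarrow> bij_betw (\<theta> M) (Hom (Comod_cat \<U> R C) Q M) (Hom (Mod_cat \<U> S) B (fobj F M))"
    "\<And>M N f h. obj M \<Longrightarrow> obj N \<Longrightarrow> f \<in> Hom (Comod_cat \<U> R C) M N \<Longrightarrow> h \<in> Hom (Comod_cat \<U> R C) Q M \<Longrightarrow>
      \<theta> N (Comp (Comod_cat \<U> R C) Q M N f h) =
      Comp (Mod_cat \<U> S) B (fobj F M) (fobj F N) (fmap F M N f) (\<theta> M h)"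
proof -
  have BM: "left_module S B" "carrier B \<in> \<U>"
    using B by (auto simp: Mod_cat_def)
  interpret B: left_module S B by (rule BM)
  interpret X: comod_right_action R C A S B act
    by (intro comod_right_action.intro A_comodule BM act)
  have "carrier A \<in> \<U>" using A_obj by (simp add: obj_iff)
  then obtain W where W: "W \<in> \<U>" "infinite W" "lepoll (carrier A) W" "lepoll (carrier B) W"
    using universe_common_bound[OF universe _ BM(2)] by metis
  have "lepoll (carrier X.tensor_comod) W"
    using tensor_group_lepoll[OF W(2), of X.A\<sigma> B S] W(3,4) by simp
  then obtain Q e e' where Q: "obj Q" "carrier Q = e ` carrier X.tensor_comod"
    and e: "e \<in> comod_hom R C X.tensor_comod Q" and e': "e' \<in> comod_hom R C Q X.tensor_comod"
    and e'e: "\<And>x. x \<in> carrier X.tensor_comod \<Longrightarrow> e' (e x) = x"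
    using obj_transport[OF X.left_comodule_tensor_comod W(1)] by metis
  note QC = obj_comodule[OF Q(1)] and TC = X.left_comodule_tensor_comod
  \<comment> \<open>The generating maps a \<mapsto> a \<otimes> b, moved to the copy
    \<open>Q\<close> inside the universe.\<close>
  define v where "v b a = e (X.u b a)" for b a
  have v: "v b \<in> hom A Q" if "b \<in> carrier B" for b
    unfolding v_def[abs_def] by (rule comod_hom_comp[OF A_comodule TC QC X.u_comod_hom[OF that] e])
  have v_add: "v (b \<oplus>\<^bsub>B\<^esub> b') a = v b a \<oplus>\<^bsub>Q\<^esub> v b' a"
    if "a \<in> carrier A" "b \<in> carrier B" "b' \<in> carrier B" for a b b'
    using that lmod_hom_add[OF comod_hom_lmod_hom[OF e], of "X.u b a" "X.u b' a"]
    by (simp add: v_def X.u_add_left X.u_closed)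
  have v_smult: "v (s \<odot>\<^bsub>B\<^esub> b) a = v b (act s a)"
    if "a \<in> carrier A" "b \<in> carrier B" "s \<in> carrier S" for a b s
    using that by (simp add: v_def X.u_smult)
  have hv: "(\<lambda>a. h (v b a)) \<in> hom A M" if "obj M" "h \<in> hom Q M" "b \<in> carrier B" for M h b
    by (rule comod_hom_comp[OF A_comodule QC obj_comodule[OF that(1)] v[OF that(3)] that(2)])
  define \<theta> where "\<theta> M h = restrict (\<lambda>b. \<Phi> M (\<lambda>a. h (v b a))) (carrier B)" for M h
  have \<theta>_hom: "\<theta> M h \<in> Hom (Mod_cat \<U> S) B (fobj F M)" if M: "obj M" and h: "h \<in> hom Q M" for M h
  proof -
    interpret FM: left_module S "fobj F M" by (rule F_module[OF M])
    have "\<theta> M h \<in> lmod_hom S B (fobj F M)"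
    proof (rule lmod_homI[OF additiveI])
      show "\<theta> M h b \<in> carrier (fobj F M)" if "b \<in> carrier B" for b
        using that by (simp add: \<theta>_def \<Phi>_closed[OF M hv[OF M h]])
      show "\<theta> M h (b \<oplus>\<^bsub>B\<^esub> b') = \<theta> M h b \<oplus>\<^bsub>fobj F M\<^esub> \<theta> M h b'" if b: "b \<in> carrier B" "b' \<in> carrier B" for b b'
      proof -
        have "\<Phi> M (\<lambda>a. h (v (b \<oplus>\<^bsub>B\<^esub> b') a)) = \<Phi> M (\<lambda>a. h (v b a) \<oplus>\<^bsub>M\<^esub> h (v b' a))"
          using b by (intro \<Phi>_cong) (simp add: v_add lmod_hom_add[OF comod_hom_lmod_hom[OF h]]
              comod_hom_closed[OF v])
        also have "\<dots> = \<Phi> M (\<lambda>a. h (v b a)) \<oplus>\<^bsub>fobj F M\<^esub> \<Phi> M (\<lambda>a. h (v b' a))"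
          by (rule \<Phi>_add(2)[OF M hv[OF M h b(1)] hv[OF M h b(2)]])
        finally show ?thesis using b by (simp add: \<theta>_def)
      qed
      show "\<theta> M h (s \<odot>\<^bsub>B\<^esub> b) = s \<odot>\<^bsub>fobj F M\<^esub> \<theta> M h b" if "s \<in> carrier S" "b \<in> carrier B" for s b
      proof -
        have "\<Phi> M (\<lambda>a. h (v (s \<odot>\<^bsub>B\<^esub> b) a)) = \<Phi> M (\<lambda>a. h (v b (act s a)))"
          using that by (intro \<Phi>_cong) (simp add: v_smult)
        also have "\<dots> = s \<odot>\<^bsub>fobj F M\<^esub> \<Phi> M (\<lambda>a. h (v b a))"
          by (rule \<Phi>_smult[OF M hv[OF M h that(2)] that(1)])
        finally show ?thesis using that by (simp add: \<theta>_def B.smult_closed)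
      qed
    qed
    then show ?thesis by (simp add: Mod_cat_def \<theta>_def)
  qed
  have Q_eqI: "h x = h' x"
    if M: "obj M" and h: "h \<in> hom Q M" "h' \<in> hom Q M" and x: "x \<in> carrier Q"
      and eq: "\<And>a b. a \<in> carrier A \<Longrightarrow> b \<in> carrier B \<Longrightarrow> h (v b a) = h' (v b a)" for M h h' x
  proof -
    obtain t where t: "t \<in> carrier X.tensor_comod" "x = e t" using x by (auto simp: Q(2))
    have "h (e t) = h' (e t)"
      by (rule X.tensor_comod_eqI[OF obj_comodule[OF M] comod_hom_comp[OF TC QC obj_comodule[OF M] e h(1)]
            comod_hom_comp[OF TC QC obj_comodule[OF M] e h(2)] _ t(1)])
        (use eq in \<open>simp add: v_def\<close>)
    then show ?thesis by (simp add: t)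
  qed
  have inj: "inj_on (\<theta> M) (Hom (Comod_cat \<U> R C) Q M)" if M: "obj M" for M
  proof (rule inj_onI)
    fix h h' assume h: "h \<in> Hom (Comod_cat \<U> R C) Q M" "h' \<in> Hom (Comod_cat \<U> R C) Q M" and eq: "\<theta> M h =
        \<theta> M h'"
    then have hh: "h \<in> hom Q M" "h' \<in> hom Q M" by (auto simp: Hom_iff)
    have "h (v b a) = h' (v b a)" if "a \<in> carrier A" "b \<in> carrier B" for a b
      by (rule \<Phi>_inj[OF M hv[OF M hh(1) that(2)] hv[OF M hh(2) that(2)] _ that(1)])
        (use fun_cong[OF eq, of b] that in \<open>simp add: \<theta>_def\<close>)
    then have "h x = h' x" if "x \<in> carrier Q" for x
      using Q_eqI[OF M hh that] by blast
    then show "h = h'"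
      using h by (intro extensionalityI[of h "carrier Q" h']) (auto simp: Hom_iff)
  qed
  have surj: "\<exists>h\<in>Hom (Comod_cat \<U> R C) Q M. \<theta> M h = g"
    if M: "obj M" and g: "g \<in> Hom (Mod_cat \<U> S) B (fobj F M)" for M g
  proof -
    have gl: "g \<in> lmod_hom S B (fobj F M)" and ge: "g \<in> extensional (carrier B)"
      using g by (simp_all add: Mod_cat_def)
    \<comment> \<open>Surjectivity of \<open>\<Phi>\<close> lifts each value of g to a map A
      \<rightarrow> M. Injectivity fixes that map on the carrier of A, so the linearity of g passes
      to the family \<open>f\<close>, as \<open>tensor_comod_lift\<close> requires.\<close>
    define f where "f b = (SOME f. f \<in> hom A M \<and> \<Phi> M f = g b)" for b
    have "f b \<in> hom A M \<and> \<Phi> M (f b) = g b" if b: "b \<in> carrier B" for b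
    proof -
      obtain k where "k \<in> hom A M" "\<Phi> M k = g b"
        by (rule \<Phi>_surj[OF M lmod_hom_closed[OF gl b]])
      then have "\<exists>f. f \<in> hom A M \<and> \<Phi> M f = g b" by blast
      from someI_ex[OF this] show ?thesis unfolding f_def .
    qed
    then have f: "\<And>b. b \<in> carrier B \<Longrightarrow> f b \<in> hom A M" "\<And>b. b \<in> carrier B \<Longrightarrow> \<Phi> M (f b) = g b"
      by simp_all
    have f_add: "f (b \<oplus>\<^bsub>B\<^esub> b') a = f b a \<oplus>\<^bsub>M\<^esub> f b' a"
      if "a \<in> carrier A" and b: "b \<in> carrier B" "b' \<in> carrier B" for a b b'
      by (rule \<Phi>_inj[OF M f(1) \<Phi>_add(1)[OF M f(1) f(1)] _ that(1)])
        (use b in \<open>simp_all add: \<Phi>_add(2)[OF M f(1) f(1)] f(2) lmod_hom_add[OF gl]\<close>)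
    have f_smult: "f (s \<odot>\<^bsub>B\<^esub> b) a = f b (act s a)"
      if "a \<in> carrier A" and b: "b \<in> carrier B" and s: "s \<in> carrier S" for a b s
      by (rule \<Phi>_inj[OF M f(1) comod_hom_comp[OF A_comodule A_comodule obj_comodule[OF M] act(1)[OF s]
          f(1)[OF b]] _ that(1)])
        (use b s in \<open>simp_all add: \<Phi>_smult[OF M f(1)] f(2) lmod_hom_smult[OF gl] B.smult_closed\<close>)
    obtain h0 where h0: "h0 \<in> comod_hom R C X.tensor_comod M"
      "\<And>a b. a \<in> carrier A \<Longrightarrow> b \<in> carrier B \<Longrightarrow> h0 (X.u b a) = f b a"
      by (rule X.tensor_comod_lift[OF obj_comodule[OF M] f(1) f_add f_smult]) (assumption+, erule that, simp)
    define h where "h = restrict (\<lambda>x. h0 (e' x)) (carrier Q)"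
    have h: "h \<in> Hom (Comod_cat \<U> R C) Q M"
      unfolding h_def by (rule restrict_Hom[OF Q(1) M comod_hom_comp[OF QC TC obj_comodule[OF M] e' h0(1)]])
    have "h (v b a) = f b a" if "a \<in> carrier A" "b \<in> carrier B" for a b
      \<comment> \<open>\<open>v\<close> stays folded in the first call, where membership in the
        carrier of Q resolves the restriction; only then is it unfolded, so that \<open>e'\<close>
        cancels \<open>e\<close>.\<close>
      using that comod_hom_closed[OF v] by (simp add: h_def) (simp add: v_def e'e X.u_closed h0(2))
    then have "\<Phi> M (\<lambda>a. h (v b a)) = g b" if "b \<in> carrier B" for b
      using \<Phi>_cong[of "\<lambda>a. h (v b a)" "f b" M] f(2)[OF that] that by simp
    then have "\<theta> M h = g"
      using ge by (intro extensionalityI[of _ "carrier B"]) (simp_all add: \<theta>_def)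
    with h show ?thesis by blast
  qed
  show ?thesis
  proof (rule that[OF Q(1), of \<theta>])
    fix M assume M: "obj M"
    show "bij_betw (\<theta> M) (Hom (Comod_cat \<U> R C) Q M) (Hom (Mod_cat \<U> S) B (fobj F M))"
      unfolding bij_betw_def
    proof (intro conjI inj[OF M] equalityI subsetI)
      fix g assume "g \<in> \<theta> M ` Hom (Comod_cat \<U> R C) Q M"
      then show "g \<in> Hom (Mod_cat \<U> S) B (fobj F M)"
        using \<theta>_hom[OF M] by (auto simp: Hom_iff)
    qed (use surj[OF M] in blast)
  next
    fix M N f h
    assume M: "obj M" and N: "obj N" and fH: "f \<in> Hom (Comod_cat \<U> R C) M N" and hH: "h \<in> Hom (Comod_cat
        \<U> R C) Q M"
    then have f: "f \<in> hom M N" and fe: "restrict f (carrier M) = f" and h: "h \<in> hom Q M"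
      by (auto simp: Hom_iff extensional_restrict)
    \<comment> \<open>Arrows are compared as functions on the whole type; outside the carrier of B
      both sides are \<open>undefined\<close>.\<close>
    have "\<theta> N (compose (carrier Q) f h) b = compose (carrier B) (fmap F M N f) (\<theta> M h) b" for b
    proof (cases "b \<in> carrier B")
      case True
      have "\<Phi> N (\<lambda>a. compose (carrier Q) f h (v b a)) = \<Phi> N (\<lambda>a. f (h (v b a)))"
        by (rule \<Phi>_cong) (simp add: compose_eq comod_hom_closed[OF v[OF True]])
      also have "\<dots> = fmap F M N f (\<Phi> M (\<lambda>a. h (v b a)))"
        using \<Phi>_nat[OF M N f hv[OF M h True]] fe by simp
      finally show ?thesis using True by (simp add: \<theta>_def compose_eq)
    qed (simp add: \<theta>_def compose_def)
    then show "\<theta> N (Comp (Comod_cat \<U> R C) Q M N f h) =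
      Comp (Mod_cat \<U> S) B (fobj F M) (fobj F N) (fmap F M N f) (\<theta> M h)"
      by (auto simp: Comod_cat_def Mod_cat_def)
  qed
qed

end

section \<open>Representability of the composite\<close>

lemma set_representable_forgetfulE:
  assumes "set_representable \<C> (forgetful \<circ>\<^sub>F F)"
  obtains A \<phi> where "A \<in> Obj \<C>"
    "\<And>M. M \<in> Obj \<C> \<Longrightarrow> bij_betw (\<phi> M) (Hom \<C> A M) (carrier (fobj F M))"
    "\<And>M N f h. M \<in> Obj \<C> \<Longrightarrow> N \<in> Obj \<C> \<Longrightarrow> f \<in> Hom \<C> M N \<Longrightarrow> h \<in> Hom \<C> A M \<Longrightarrow>
      \<phi> N (Comp \<C> A M N f h) = fmap F M N f (\<phi> M h)"
proof -
  from assms obtain A \<phi> where "A \<in> Obj \<C>"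
    and bij: "\<forall>M\<in>Obj \<C>. bij_betw (\<phi> M) (Hom \<C> A M) (carrier (fobj F M))"
    and nat: "\<forall>M\<in>Obj \<C>. \<forall>N\<in>Obj \<C>. \<forall>f\<in>Hom \<C> M N. \<forall>h\<in>Hom \<C> A M.
      \<phi> N (Comp \<C> A M N f h) = fmap F M N f (\<phi> M h)"
    by (auto simp: set_representable_def forgetful_def fcomp_def)
  then show ?thesis
    using that[of A \<phi>] by simp
qed

lemma is_functor_fcomp:
  assumes "is_functor \<C> \<D> F" "is_functor \<D> \<E> G"
  shows "is_functor \<C> \<E> (G \<circ>\<^sub>F F)"
  using assms by (simp add: is_functor_def fcomp_def)

theorem corollary3p2:
  fixes R :: "'r ring" and S :: "'s ring" and T :: "'t ring"
    and C :: "('r, 'c) coring"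
    and \<U> :: "'u set set"
    and F :: "(('r, 'u, 'c) comodule, 'u \<Rightarrow> 'u, ('s, 'u) module, 'u \<Rightarrow> 'u) fctr"
    and G :: "(('s, 'u) module, 'u \<Rightarrow> 'u, ('t, 'u) module, 'u \<Rightarrow> 'u) fctr"
  assumes "universe \<U>"
    and "ring R" and "ring S" and "ring T" and "coring R C"
    and "representable_functor (Comod_cat \<U> R C) \<U> S F"
    and "representable_functor (Mod_cat \<U> S) \<U> T G"
  shows "representable_functor (Comod_cat \<U> R C) \<U> T (G \<circ>\<^sub>F F)"
proof -
  let ?C = "Comod_cat \<U> R C" and ?S = "Mod_cat \<U> S"
  have F: "is_functor ?C ?S F" and G: "is_functor ?S (Mod_cat \<U> T) G"
    using assms(6,7) by (simp_all add: representable_functor_def)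
  obtain A \<phi> where A: "A \<in> Obj ?C"
    "\<And>M. M \<in> Obj ?C \<Longrightarrow> bij_betw (\<phi> M) (Hom ?C A M) (carrier (fobj F M))"
    "\<And>M N f h. M \<in> Obj ?C \<Longrightarrow> N \<in> Obj ?C \<Longrightarrow> f \<in> Hom ?C M N \<Longrightarrow> h \<in> Hom ?C A M \<Longrightarrow>
      \<phi> N (Comp ?C A M N f h) = fmap F M N f (\<phi> M h)"
    using assms(6) unfolding representable_functor_def
    by (elim conjE set_representable_forgetfulE) blast
  interpret comodule_representation \<U> R C S F A \<phi>
    by (intro comodule_representation.intro assms(1) F A)
  obtain B \<psi> where B: "B \<in> Obj ?S"
    "\<And>M. M \<in> Obj ?S \<Longrightarrow> bij_betw (\<psi> M) (Hom ?S B M) (carrier (fobj G M))"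
    "\<And>M N f h. M \<in> Obj ?S \<Longrightarrow> N \<in> Obj ?S \<Longrightarrow> f \<in> Hom ?S M N \<Longrightarrow> h \<in> Hom ?S B M \<Longrightarrow>
      \<psi> N (Comp ?S B M N f h) = fmap G M N f (\<psi> M h)"
    using assms(7) unfolding representable_functor_def
    by (elim conjE set_representable_forgetfulE) blast
  obtain Q \<theta> where Q: "Q \<in> Obj ?C"
    "\<And>M. M \<in> Obj ?C \<Longrightarrow> bij_betw (\<theta> M) (Hom ?C Q M) (Hom ?S B (fobj F M))"
    "\<And>M N f h. M \<in> Obj ?C \<Longrightarrow> N \<in> Obj ?C \<Longrightarrow> f \<in> Hom ?C M N \<Longrightarrow> h \<in> Hom ?C Q M \<Longrightarrow>
      \<theta> N (Comp ?C Q M N f h) = Comp ?S B (fobj F M) (fobj F N) (fmap F M N f) (\<theta> M h)"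
    by (rule Hom_representable[OF B(1)]) blast
  have Fo: "fobj F M \<in> Obj ?S" if "M \<in> Obj ?C" for M
    using F that by (simp add: is_functor_def)
  have Fm: "fmap F M N f \<in> Hom ?S (fobj F M) (fobj F N)" if "M \<in> Obj ?C" "N \<in> Obj ?C" "f \<in> Hom ?C M N"
      for M N f
    using F that by (simp add: is_functor_def)
  \<comment> \<open>Evaluating \<open>\<psi>\<close> at the module F M identifies Hom(B, F M) with G
    (F M); composed with \<open>\<theta>\<close> it yields the bijection from Hom(Q, M). Naturality
    of \<open>\<psi>\<close> is used at the linear map F f.\<close>
  have "set_representable ?C (forgetful \<circ>\<^sub>F (G \<circ>\<^sub>F F))"
    unfolding set_representable_def
  proof (intro bexI[OF _ Q(1)] exI[of _ "\<lambda>M h. \<psi> (fobj F M) (\<theta> M h)"] conjI ballI)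
    fix M assume M: "M \<in> Obj ?C"
    show "bij_betw (\<lambda>h. \<psi> (fobj F M) (\<theta> M h)) (Hom ?C Q M) (fobj (forgetful \<circ>\<^sub>F (G \<circ>\<^sub>F F)) M)"
      using bij_betw_trans[OF Q(2)[OF M] B(2)[OF Fo[OF M]]]
      by (simp add: forgetful_def fcomp_def comp_def)
  next
    fix M N f h
    assume M: "M \<in> Obj ?C" and N: "N \<in> Obj ?C" and f: "f \<in> Hom ?C M N" and h: "h \<in> Hom ?C Q M"
    have "\<theta> M h \<in> Hom ?S B (fobj F M)"
      using Q(2)[OF M] h by (auto dest: bij_betwE)
    then show "\<psi> (fobj F N) (\<theta> N (Comp ?C Q M N f h)) =
        fmap (forgetful \<circ>\<^sub>F (G \<circ>\<^sub>F F)) M N f (\<psi> (fobj F M) (\<theta> M h))"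
      by (simp add: Q(3)[OF M N f h] B(3)[OF Fo[OF M] Fo[OF N] Fm[OF M N f]] forgetful_def fcomp_def)
  qed
  then show ?thesis
    using is_functor_fcomp[OF F G] by (simp add: representable_functor_def)
qed

end
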